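(* Let $(E,\omega)$ be an LV-graph and $R$ a domain. Then $L_R(E,\omega)$ is a prime ring.
   Context: A weighted graph $(E,\omega)$, $E=(E^0,E^{\mathrm{st}},E^1,s,r,\omega)$, consists of countable sets $E^0$ (vertices), $E^{\mathrm{st}}$ (structured edges), $E^1$ (edges), maps $s,r:E^{\mathrm{st}}\to E^0$ and a weight map $\omega:E^{\mathrm{st}}\to\mathbb N=\{1,2,\dots\}$ such that $E^1=\bigsqcup_{\alpha\in E^{\mathrm{st}}}\{\alpha_1,\dots,\alpha_{\omega(\alpha)}\}$. All weighted graphs are assumed row-finite: $s^{-1}(v)\subseteq E^{\mathrm{st}}$ is finite for every $v\in E^0$. A vertex $v$ is a sink if $s^{-1}(v)=\emptyset$; if $v$ is not a sink, $\omega(v):=\max\{\omega(\alpha)\mid\alpha\in s^{-1}(v)\}$. Rings of coefficients $R$ are unital. Let $(E^1)^*=\{\alpha_i^*\mid\alpha_i\in E^1\}$, $X=E^0\cup E^1\cup(E^1)^*$, and let $R\langle X\rangle$ be the free (non-unital) $R$-ring on $X$: the free left $R$-module on the nonempty words over $X$ with multiplication $(\sum r_xx)(\sum s_yy)=\sum r_xs_y\,xy$. The weighted Leavitt path algebra $L_R(E,\omega)$ is the quotient of $R\langle X\rangle$ by the ideal generated by the relations: (1) $vw=\delta_{vw}v$ for $v,w\in E^0$; (2) $s(\alpha)\alpha_i=\alpha_ir(\alpha)=\alpha_i$ and $r(\alpha)\alpha_i^*=\alpha_i^*s(\alpha)=\alpha_i^*$ for $\alpha\in E^{\mathrm{st}}$,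 $1\le i\le\omega(\alpha)$; (3) $\sum_{\alpha\in s^{-1}(v)}\alpha_i\alpha_j^*=\delta_{ij}v$ for every non-sink $v$ and $1\le i,j\le\omega(v)$; (4) $\sum_{1\le i\le\max\{\omega(\alpha),\omega(\beta)\}}\alpha_i^*\beta_i=\delta_{\alpha\beta}r(\alpha)$ for all $\alpha,\beta\in E^{\mathrm{st}}$; where in (3) and (4) $\alpha_i:=\alpha_i^*:=0$ whenever $i>\omega(\alpha)$. A generalised path is a single vertex $v$ (with $s(v)=r(v)=v$) or a word $x_1\cdots x_n$, $n\ge1$, $x_i\in E^1\cup(E^1)^*$ with $r(x_i)=s(x_{i+1})$, going from $s(x_1)$ to $r(x_n)$, where $s(\alpha_i)=s(\alpha)$, $r(\alpha_i)=r(\alpha)$, $s(\alpha_i^* )=r(\alpha)$, $r(\alpha_i^* )=s(\alpha)$. An LV-graph is a weighted graph such that $\omega(\alpha)\ge2$ for all $\alpha\in E^{\mathrm{st}}$; $|\{\alpha\in s^{-1}(v)\mid\omega(\alpha)=\omega(v)\}|\ge2$ for every non-sink $v\in E^0$; $E^{\mathrm{st}}\ne\emptyset$; and $(E,\omega)$ is connected, i.e. for any $u,v\in E^0$ there is a generalised path from $u$ to $v$. The algebra $L_R(E,\omega)$ has local units but need not be unital. *)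

theory Defs
  imports
    "HOL-Library.Countable_Set"
    "HOL-Library.Poly_Mapping"
    "HOL-Algebra.QuotRing"
    "HOL-Algebra.Ideal_Product"
    "Graph_Theory.Digraph"
begin

section \<open>Rings without unit\<close>

text \<open>
  The record type of rings from HOL-Algebra is reused for rings that need not have a unit. Its
  field \<open>one\<close> then carries no information: nothing below depends on it, and \<^const>\<open>FactRing\<close>
  uses it only to fill in the field \<open>one\<close> of the quotient.
\<close>

locale rng = abelian_group R for R (structure) +
  assumes m_closed [simp, intro]:
      "\<lbrakk>x \<in> carrier R; y \<in> carrier R\<rbrakk> \<Longrightarrow> x \<otimes> y \<in> carrier R"
    and m_assoc:
      "\<lbrakk>x \<in> carrier R; y \<in> carrier R; z \<in> carrier R\<rbrakk> \<Longrightarrow> (x \<otimes> y) \<otimes> z = x \<otimes> (y \<otimes> z)"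
    and l_distr:
      "\<lbrakk>x \<in> carrier R; y \<in> carrier R; z \<in> carrier R\<rbrakk> \<Longrightarrow> (x \<oplus> y) \<otimes> z = x \<otimes> z \<oplus> y \<otimes> z"
    and r_distr:
      "\<lbrakk>x \<in> carrier R; y \<in> carrier R; z \<in> carrier R\<rbrakk> \<Longrightarrow> z \<otimes> (x \<oplus> y) = z \<otimes> x \<oplus> z \<otimes> y"

locale rng_ideal = additive_subgroup I R + rng R for I and R (structure) +
  assumes I_l_closed: "\<lbrakk>a \<in> I; x \<in> carrier R\<rbrakk> \<Longrightarrow> x \<otimes> a \<in> I"
    and I_r_closed: "\<lbrakk>a \<in> I; x \<in> carrier R\<rbrakk> \<Longrightarrow> a \<otimes> x \<in> I"

locale prime_rng = rng R for R (structure) +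
  assumes carrier_not_zero: "carrier R \<noteq> {\<zero>}"
    and prime:
      "\<lbrakk>rng_ideal I R; rng_ideal J R; ideal_prod R I J = {\<zero>}\<rbrakk> \<Longrightarrow> I = {\<zero>} \<or> J = {\<zero>}"

sublocale rng_ideal \<subseteq> abelian_subgroup I R
  by (rule abelian_subgroupI3) unfold_locales

lemma (in rng_ideal) rcoset_mult_add:
  assumes "x \<in> carrier R" "y \<in> carrier R"
  shows "[mod I:] (I +> x) \<Otimes> (I +> y) = I +> (x \<otimes> y)"
proof -
  have "I +> (a \<otimes> b) = I +> (x \<otimes> y)" if ab: "a \<in> I +> x" "b \<in> I +> y" for a b
  proof -
    obtain h k where h: "h \<in> I" "a = h \<oplus> x" and k: "k \<in> I" "b = k \<oplus> y"
      using ab by (auto simp: a_r_coset_def r_coset_def)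
    have carr: "h \<in> carrier R" "k \<in> carrier R" using h k by auto
    have "a \<otimes> b = (h \<otimes> b \<oplus> x \<otimes> k) \<oplus> x \<otimes> y"
      using h k carr assms by (simp add: l_distr r_distr a_assoc a_lcomm)
    moreover have "h \<otimes> b \<oplus> x \<otimes> k \<in> I"
      using additive_subgroup.a_closed[OF additive_subgroup_axioms] I_r_closed[of h b]
        I_l_closed[of k x] h k carr assms by simp
    ultimately have "a \<otimes> b \<in> I +> (x \<otimes> y)"
      by (auto simp: a_r_coset_def r_coset_def)
    then show ?thesis
      using a_repr_independence' assms by blast
  qed
  then show ?thesis
    unfolding rcoset_mult_def using a_rcos_self[OF assms(1)] a_rcos_self[OF assms(2)]
    by blast
qed

lemma (in rng_ideal) quotient_is_rng: "rng (R Quot I)"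
proof (intro rng.intro rng_axioms.intro)
  show "abelian_group (R Quot I)"
    by (rule comm_group_abelian_groupI)
      (simp add: FactRing_def a_factorgroup_is_comm_group[unfolded A_FactGroup_def'])
qed (auto simp: FactRing_simps rcoset_mult_add a_rcos_sum m_assoc l_distr r_distr)


section \<open>Free rings\<close>

instantiation list :: (type) monoid_add
begin

definition zero_list :: "'a list" where "zero_list = []"

definition plus_list :: "'a list \<Rightarrow> 'a list \<Rightarrow> 'a list" where "plus_list = (@)"

instance
  by standard (simp_all add: zero_list_def plus_list_def)

end

text \<open>
  With addition of lists being concatenation, the type \<^typ>\<open>'x list \<Rightarrow>\<^sub>0 'r\<close> with its convolution
  product is the free unital ring over \<^typ>\<open>'r\<close> on all of \<^typ>\<open>'x\<close>. The free non-unital ring on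
  the set \<open>X\<close> consists of those elements supported on the nonempty words over \<open>X\<close>.
\<close>

definition free_rng :: "'x set \<Rightarrow> ('x list \<Rightarrow>\<^sub>0 'r::ring_1) ring" where
  "free_rng X =
    \<lparr>carrier = {f. Poly_Mapping.keys f \<subseteq> lists X - {[]}},
     monoid.mult = (*), one = undefined, zero = 0, add = (+)\<rparr>"

definition letter :: "'x \<Rightarrow> ('x list \<Rightarrow>\<^sub>0 'r::ring_1)" where
  "letter x = Poly_Mapping.single [x] 1"

text \<open>
  Ideals of the free ring are required to be left submodules over the coefficients. Without a unit
  this is not automatic: for a letter \<open>x\<close>, the element \<open>r (x x - x)\<close> need not lie in the ring ideal
  generated by \<open>x x - x\<close>.
\<close>

definition coeff_ideal :: "('x list \<Rightarrow>\<^sub>0 'r::ring_1) set \<Rightarrow> 'x set \<Rightarrow> bool" where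
  "coeff_ideal I X \<longleftrightarrow>
    rng_ideal I (free_rng X) \<and> (\<forall>r. \<forall>f\<in>I. Poly_Mapping.map ((*) r) f \<in> I)"

definition gen_coeff_ideal :: "'x set \<Rightarrow> ('x list \<Rightarrow>\<^sub>0 'r::ring_1) set \<Rightarrow> ('x list \<Rightarrow>\<^sub>0 'r) set" where
  "gen_coeff_ideal X S = \<Inter>{I. coeff_ideal I X \<and> S \<subseteq> I}"

lemma rng_free_rng: "rng (free_rng X :: ('x list \<Rightarrow>\<^sub>0 'r::ring_1) ring)"
proof -
  let ?F = "free_rng X :: ('x list \<Rightarrow>\<^sub>0 'r) ring"
  have add: "f + g \<in> carrier ?F" if "f \<in> carrier ?F" "g \<in> carrier ?F" for f g
    using that Poly_Mapping.keys_add[of f g] by (auto simp: free_rng_def)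
  have neg: "- f \<in> carrier ?F" if "f \<in> carrier ?F" for f
    using that by (simp add: free_rng_def)
  have mult: "f * g \<in> carrier ?F" if "f \<in> carrier ?F" "g \<in> carrier ?F" for f g
    using that keys_mult[of f g] by (fastforce simp: free_rng_def plus_list_def)
  have "abelian_group ?F"
  proof (rule abelian_groupI)
    fix f assume "f \<in> carrier ?F"
    then show "\<exists>g\<in>carrier ?F. g \<oplus>\<^bsub>?F\<^esub> f = \<zero>\<^bsub>?F\<^esub>"
      using neg[of f] by (intro bexI[of _ "- f"]) (simp_all add: free_rng_def)
  qed (use add in \<open>simp_all add: free_rng_def add.assoc add.commute\<close>)
  then show ?thesis
    by (intro rng.intro rng_axioms.intro)
      (use mult in \<open>simp_all add: free_rng_def mult.assoc distrib_left distrib_right\<close>)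
qed

lemma coeff_ideal_carrier:
  "coeff_ideal (carrier (free_rng X) :: ('x list \<Rightarrow>\<^sub>0 'r::ring_1) set) X"
proof -
  let ?F = "free_rng X :: ('x list \<Rightarrow>\<^sub>0 'r) ring"
  interpret rng ?F by (rule rng_free_rng)
  have "subgroup (carrier ?F) (add_monoid ?F)"
    using add.subgroup_self by simp
  then have "rng_ideal (carrier ?F) ?F"
    by (intro rng_ideal.intro rng_ideal_axioms.intro additive_subgroup.intro) (auto simp: rng_axioms)
  moreover have "Poly_Mapping.map ((*) r) f \<in> carrier ?F" if "f \<in> carrier ?F" for r f
    using that by (auto simp: free_rng_def Poly_Mapping.map.rep_eq in_keys_iff when_def subset_iff)
  ultimately show ?thesis
    by (simp add: coeff_ideal_def)
qed

lemma coeff_ideal_gen_coeff_ideal: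
  fixes S :: "('x list \<Rightarrow>\<^sub>0 'r::ring_1) set"
  assumes "S \<subseteq> carrier (free_rng X)"
  shows "coeff_ideal (gen_coeff_ideal X S) X"
proof -
  let ?F = "free_rng X :: ('x list \<Rightarrow>\<^sub>0 'r) ring"
  let ?\<I> = "{I. coeff_ideal I X \<and> S \<subseteq> I}"
  interpret rng ?F by (rule rng_free_rng)
  have ne: "?\<I> \<noteq> {}" using coeff_ideal_carrier assms by blast
  have sub: "subgroup (\<Inter>?\<I>) (add_monoid ?F)"
    using ne
    by (intro add.subgroups_Inter)
      (auto simp: coeff_ideal_def rng_ideal_def additive_subgroup_def)
  have "rng_ideal (\<Inter>?\<I>) ?F"
    using sub
    by (intro rng_ideal.intro rng_ideal_axioms.intro additive_subgroup.intro)
      (auto simp: rng_axioms coeff_ideal_def rng_ideal.I_l_closed rng_ideal.I_r_closed)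
  then show ?thesis
    by (auto simp: gen_coeff_ideal_def coeff_ideal_def)
qed


section \<open>Weighted graphs\<close>

text \<open>
  The structured edges of the weighted graph are the arcs of \<open>E\<close>. The edges are the pairs of an
  arc \<open>\<alpha>\<close> and an index between \<open>1\<close> and \<open>\<omega> \<alpha>\<close>.
\<close>

locale weighted_graph = wf_digraph E
  for E :: "('v, 'e) pre_digraph" and \<omega> :: "'e \<Rightarrow> nat" +
  assumes countable_verts: "countable (verts E)"
    and countable_arcs: "countable (arcs E)"
    and weight_pos: "\<alpha> \<in> arcs E \<Longrightarrow> 1 \<le> \<omega> \<alpha>"
    and row_finite: "v \<in> verts E \<Longrightarrow> finite (out_arcs E v)"

definition vertex_weight :: "('v, 'e) pre_digraph \<Rightarrow> ('e \<Rightarrow> nat) \<Rightarrow> 'v \<Rightarrow> nat" where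
  "vertex_weight E \<omega> v = Max (\<omega> ` out_arcs E v)"

datatype ('v, 'e) symbol = Vertex 'v | Edge 'e nat | Ghost 'e nat

definition edges :: "('v, 'e) pre_digraph \<Rightarrow> ('e \<Rightarrow> nat) \<Rightarrow> ('v, 'e) symbol set" where
  "edges E \<omega> = {Edge \<alpha> i | \<alpha> i. \<alpha> \<in> arcs E \<and> 1 \<le> i \<and> i \<le> \<omega> \<alpha>}"

definition ghosts :: "('v, 'e) pre_digraph \<Rightarrow> ('e \<Rightarrow> nat) \<Rightarrow> ('v, 'e) symbol set" where
  "ghosts E \<omega> = {Ghost \<alpha> i | \<alpha> i. \<alpha> \<in> arcs E \<and> 1 \<le> i \<and> i \<le> \<omega> \<alpha>}"

definition symbols :: "('v, 'e) pre_digraph \<Rightarrow> ('e \<Rightarrow> nat) \<Rightarrow> ('v, 'e) symbol set" where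
  "symbols E \<omega> = Vertex ` verts E \<union> edges E \<omega> \<union> ghosts E \<omega>"

fun source :: "('v, 'e) pre_digraph \<Rightarrow> ('v, 'e) symbol \<Rightarrow> 'v" where
  "source E (Vertex v) = v"
| "source E (Edge \<alpha> i) = tail E \<alpha>"
| "source E (Ghost \<alpha> i) = head E \<alpha>"

fun target :: "('v, 'e) pre_digraph \<Rightarrow> ('v, 'e) symbol \<Rightarrow> 'v" where
  "target E (Vertex v) = v"
| "target E (Edge \<alpha> i) = head E \<alpha>"
| "target E (Ghost \<alpha> i) = tail E \<alpha>"

definition generalised_path ::
  "('v, 'e) pre_digraph \<Rightarrow> ('e \<Rightarrow> nat) \<Rightarrow> ('v, 'e) symbol list \<Rightarrow> bool" where
  "generalised_path E \<omega> p \<longleftrightarrow>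
    (\<exists>v\<in>verts E. p = [Vertex v]) \<or>
    (p \<noteq> [] \<and> set p \<subseteq> edges E \<omega> \<union> ghosts E \<omega> \<and>
     successively (\<lambda>x y. target E x = source E y) p)"

locale LV_graph = weighted_graph E \<omega>
  for E :: "('v, 'e) pre_digraph" and \<omega> :: "'e \<Rightarrow> nat" +
  assumes weight_ge_2: "\<alpha> \<in> arcs E \<Longrightarrow> 2 \<le> \<omega> \<alpha>"
    and two_maximal:
      "\<lbrakk>v \<in> verts E; out_arcs E v \<noteq> {}\<rbrakk>
        \<Longrightarrow> 2 \<le> card {\<alpha> \<in> out_arcs E v. \<omega> \<alpha> = vertex_weight E \<omega> v}"
    and arcs_nonempty: "arcs E \<noteq> {}"
    and connected:
      "\<lbrakk>u \<in> verts E; v \<in> verts E\<rbrakk>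
        \<Longrightarrow> \<exists>p. generalised_path E \<omega> p \<and> source E (hd p) = u \<and> target E (last p) = v"


section \<open>Weighted Leavitt path algebras\<close>

definition vertex_elt :: "'v \<Rightarrow> (('v, 'e) symbol list \<Rightarrow>\<^sub>0 'r::ring_1)" where
  "vertex_elt v = letter (Vertex v)"

definition edge_elt :: "('e \<Rightarrow> nat) \<Rightarrow> 'e \<Rightarrow> nat \<Rightarrow> (('v, 'e) symbol list \<Rightarrow>\<^sub>0 'r::ring_1)" where
  "edge_elt \<omega> \<alpha> i = (if i \<le> \<omega> \<alpha> then letter (Edge \<alpha> i) else 0)"

definition ghost_elt :: "('e \<Rightarrow> nat) \<Rightarrow> 'e \<Rightarrow> nat \<Rightarrow> (('v, 'e) symbol list \<Rightarrow>\<^sub>0 'r::ring_1)" where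
  "ghost_elt \<omega> \<alpha> i = (if i \<le> \<omega> \<alpha> then letter (Ghost \<alpha> i) else 0)"

definition wlpa_relations ::
  "('v, 'e) pre_digraph \<Rightarrow> ('e \<Rightarrow> nat) \<Rightarrow> (('v, 'e) symbol list \<Rightarrow>\<^sub>0 'r::ring_1) set" where
  "wlpa_relations E \<omega> =
     {vertex_elt v * vertex_elt w - (if v = w then vertex_elt v else 0) | v w.
        v \<in> verts E \<and> w \<in> verts E} \<union>
     {vertex_elt (tail E \<alpha>) * edge_elt \<omega> \<alpha> i - edge_elt \<omega> \<alpha> i | \<alpha> i.
        \<alpha> \<in> arcs E \<and> i \<in> {1..\<omega> \<alpha>}} \<union>
     {edge_elt \<omega> \<alpha> i * vertex_elt (head E \<alpha>) - edge_elt \<omega> \<alpha> i | \<alpha> i.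
        \<alpha> \<in> arcs E \<and> i \<in> {1..\<omega> \<alpha>}} \<union>
     {vertex_elt (head E \<alpha>) * ghost_elt \<omega> \<alpha> i - ghost_elt \<omega> \<alpha> i | \<alpha> i.
        \<alpha> \<in> arcs E \<and> i \<in> {1..\<omega> \<alpha>}} \<union>
     {ghost_elt \<omega> \<alpha> i * vertex_elt (tail E \<alpha>) - ghost_elt \<omega> \<alpha> i | \<alpha> i.
        \<alpha> \<in> arcs E \<and> i \<in> {1..\<omega> \<alpha>}} \<union>
     {(\<Sum>\<alpha>\<in>out_arcs E v. edge_elt \<omega> \<alpha> i * ghost_elt \<omega> \<alpha> j)
        - (if i = j then vertex_elt v else 0) | v i j.
        v \<in> verts E \<and> out_arcs E v \<noteq> {} \<and>
        i \<in> {1..vertex_weight E \<omega> v} \<and> j \<in> {1..vertex_weight E \<omega> v}} \<union>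
     {(\<Sum>i = 1..max (\<omega> \<alpha>) (\<omega> \<beta>). ghost_elt \<omega> \<alpha> i * edge_elt \<omega> \<beta> i)
        - (if \<alpha> = \<beta> then vertex_elt (head E \<alpha>) else 0) | \<alpha> \<beta>.
        \<alpha> \<in> arcs E \<and> \<beta> \<in> arcs E}"

definition wlpa ::
  "('v, 'e) pre_digraph \<Rightarrow> ('e \<Rightarrow> nat) \<Rightarrow> (('v, 'e) symbol list \<Rightarrow>\<^sub>0 'r::ring_1) set ring" where
  "wlpa E \<omega> =
    free_rng (symbols E \<omega>) Quot gen_coeff_ideal (symbols E \<omega>) (wlpa_relations E \<omega>)"

lemma (in weighted_graph) wlpa_relations_subset:
  "(wlpa_relations E \<omega> :: (('v, 'e) symbol list \<Rightarrow>\<^sub>0 'r::ring_1) set)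
    \<subseteq> carrier (free_rng (symbols E \<omega>))"
proof -
  let ?C = "carrier (free_rng (symbols E \<omega>)) :: (('v, 'e) symbol list \<Rightarrow>\<^sub>0 'r) set"
  interpret F: rng "free_rng (symbols E \<omega>) :: (('v, 'e) symbol list \<Rightarrow>\<^sub>0 'r) ring"
    by (rule rng_free_rng)
  have zero: "0 \<in> ?C" by (simp add: free_rng_def)
  have add: "f + g \<in> ?C" if "f \<in> ?C" "g \<in> ?C" for f g
    using F.a_closed[OF that] by (simp add: free_rng_def)
  have mult: "f * g \<in> ?C" if "f \<in> ?C" "g \<in> ?C" for f g
    using F.m_closed[OF that] by (simp add: free_rng_def)
  have diff: "f - g \<in> ?C" if "f \<in> ?C" "g \<in> ?C" for f g
    using add[of f "- g"] that by (simp add: free_rng_def)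
  have sum: "(\<Sum>x\<in>A. f x) \<in> ?C" if "\<And>x. x \<in> A \<Longrightarrow> f x \<in> ?C" for A :: "'z set" and f
    using that by (induction A rule: infinite_finite_induct) (auto simp: zero add)
  have letter: "letter x \<in> ?C" if "x \<in> symbols E \<omega>" for x
    using that by (simp add: letter_def free_rng_def)
  have v: "vertex_elt v \<in> ?C" if "v \<in> verts E" for v
    using that unfolding vertex_elt_def by (intro letter) (simp add: symbols_def)
  have "Edge \<alpha> i \<in> symbols E \<omega>" "Ghost \<alpha> i \<in> symbols E \<omega>"
    if "\<alpha> \<in> arcs E" "1 \<le> i" "i \<le> \<omega> \<alpha>" for \<alpha> i
    using that by (simp_all add: symbols_def edges_def ghosts_def)
  then have e: "edge_elt \<omega> \<alpha> i \<in> ?C" and g: "ghost_elt \<omega> \<alpha> i \<in> ?C"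
    if "\<alpha> \<in> arcs E" "1 \<le> i" for \<alpha> i
    using that zero letter by (simp_all add: edge_elt_def ghost_elt_def)
  show ?thesis
    unfolding wlpa_relations_def
    by (auto intro!: diff mult sum v e g zero simp: out_arcs_def)
qed

lemma (in weighted_graph) rng_wlpa:
  "rng (wlpa E \<omega> :: (('v, 'e) symbol list \<Rightarrow>\<^sub>0 'r::ring_1) set ring)"
  unfolding wlpa_def
  using coeff_ideal_gen_coeff_ideal[OF wlpa_relations_subset]
  by (auto simp: coeff_ideal_def intro: rng_ideal.quotient_is_rng)

end

theory Submission
  imports Defs
begin

text \<open>
  Fix at every vertex that is not a sink a special outgoing arc of maximal weight. Solving
  relation (3) for the pair of symbols at the special arc, and relation (4) for the pair at index
  \<open>1\<close>, gives a rewriting system on generalised paths whose reduced paths form a basis of the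
  algebra: letting symbols act on reduced paths from the right satisfies all relations.

  The vertices are local units, and any two of them are joined by a path of symbols of index \<open>2\<close>.
  So it suffices to show \<open>f x g \<noteq> 0\<close> when \<open>x\<close> is a symbol of index \<open>2\<close> of an arc \<open>\<alpha>\<close> and the
  products \<open>f s(x)\<close> and \<open>r(x) g\<close> are nonzero. As at least two arcs of maximal weight leave every
  vertex that is not a sink, the special arcs can be chosen different from \<open>\<alpha>\<close>. Then \<open>x\<close> cannot be
  rewritten together with any neighbour, so the product of reduced expressions of \<open>f\<close>, \<open>x\<close> and \<open>g\<close>
  is already reduced.
\<close>

section \<open>Right-linear extension of functions on words\<close>

text \<open>Both relations can always be solved for the chosen pair: an arc of maximal weight occurs
  in every instance of relation (3) at its tail, and index \<open>1\<close> occurs in every instance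
  of relation (4).

  Independence of the reduced paths needs no separate confluence argument: the ideal is contained in
  the annihilator of the module which they span. The overlaps of the two rules return as the hard
  cases of the verification: a ghost of index \<open>1\<close> before a special edge of index
  \<open>1\<close> and its ghost, and a special edge and its ghost of index \<open>1\<close> before
  an edge of index \<open>1\<close>. In both, the two rewritings produce the same double sum, once
  by arcs and once by indices.

  The separating letter avoids any analysis of the cancellation that may occur where the end of
  \<open>f\<close> meets the beginning of \<open>g\<close>. Membership in the ideal does not refer
  to special arcs, so each letter of a connecting path can be treated with special arcs of its
  own.\<close>

definition scalar :: "'r \<Rightarrow> ('x list \<Rightarrow>\<^sub>0 'r::ring_1)" where
  "scalar r = Poly_Mapping.single [] r"

abbreviation word :: "'x list \<Rightarrow> ('x list \<Rightarrow>\<^sub>0 'r::ring_1)" where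
  "word w \<equiv> Poly_Mapping.single w 1"

lemma mult_single_list:
  "Poly_Mapping.single v a * Poly_Mapping.single w b = Poly_Mapping.single (v @ w) (a * b)"
  by (simp add: mult_single plus_list_def)

lemma scalar_simps [simp]:
  "scalar 0 = 0" "scalar 1 = 1" "scalar (a + b) = scalar a + scalar b"
  by (simp_all add: scalar_def single_add flip: zero_list_def)

lemma scalar_mult: "scalar (a * b) = scalar a * scalar b"
  by (simp add: scalar_def mult_single_list)

lemma single_conv_scalar: "Poly_Mapping.single w r = word w * scalar r"
  by (simp add: scalar_def mult_single_list)

lemma map_scale_conv_scalar: "Poly_Mapping.map ((*) r) f = scalar r * f"
  by (simp add: scalar_def mult_map_scale_conv_mult zero_list_def)

lemma poly_mapping_sum_singles:
  fixes f :: "'x list \<Rightarrow>\<^sub>0 'r::ring_1"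
  shows "f = (\<Sum>w\<in>Poly_Mapping.keys f. Poly_Mapping.single w (Poly_Mapping.lookup f w))"
  by (rule poly_mapping_eqI) (auto simp: lookup_sum lookup_single when_def in_keys_iff)

text \<open>Restricting the first case to words in the support of the given element keeps support
  conditions available there, although the case of sums assumes nothing about supports.\<close>

lemma single_induct [case_names single zero add]:
  fixes f :: "'x list \<Rightarrow>\<^sub>0 'r::ring_1"
  assumes "\<And>w r. w \<in> Poly_Mapping.keys f \<Longrightarrow> P (Poly_Mapping.single w r)"
    and "P 0" and "\<And>f g. P f \<Longrightarrow> P g \<Longrightarrow> P (f + g)"
  shows "P f"
proof -
  have "P (\<Sum>w\<in>A. Poly_Mapping.single w (Poly_Mapping.lookup f w))"
    if "finite A" "A \<subseteq> Poly_Mapping.keys f" for A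
    using that by (induction A) (simp_all add: assms)
  from this[of "Poly_Mapping.keys f"] show ?thesis
    by (simp flip: poly_mapping_sum_singles)
qed

definition lin ::
  "('x list \<Rightarrow> ('y list \<Rightarrow>\<^sub>0 'r)) \<Rightarrow> ('x list \<Rightarrow>\<^sub>0 'r) \<Rightarrow> ('y list \<Rightarrow>\<^sub>0 'r::ring_1)" where
  "lin h f = (\<Sum>w\<in>Poly_Mapping.keys f. h w * scalar (Poly_Mapping.lookup f w))"

lemma lin_superset:
  assumes "finite A" "Poly_Mapping.keys f \<subseteq> A"
  shows "lin h f = (\<Sum>w\<in>A. h w * scalar (Poly_Mapping.lookup f w))"
  unfolding lin_def using assms
  by (intro sum.mono_neutral_left) (auto simp: in_keys_iff)

lemma lin_zero [simp]: "lin h 0 = 0"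
  by (simp add: lin_def)

lemma lin_single [simp]: "lin h (Poly_Mapping.single w r) = h w * scalar r"
  by (simp add: lin_def)

lemma lin_add [simp]: "lin h (f + g) = lin h f + lin h g"
proof -
  let ?A = "Poly_Mapping.keys f \<union> Poly_Mapping.keys g"
  have "Poly_Mapping.keys (f + g) \<subseteq> ?A" by (rule Poly_Mapping.keys_add)
  then show ?thesis
    by (simp add: lin_superset[of ?A] lookup_add distrib_left sum.distrib)
qed

lemma lin_uminus [simp]: "lin h (- f) = - lin h f"
  using lin_add[of h f "- f"] by (simp add: eq_neg_iff_add_eq_0 add.commute)

lemma lin_diff [simp]: "lin h (f - g) = lin h f - lin h g"
  using lin_add[of h f "- g"] by simp

lemma lin_sum [simp]: "lin h (sum f A) = (\<Sum>a\<in>A. lin h (f a))"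
  by (induction A rule: infinite_finite_induct) auto

lemma lin_scalar [simp]: "lin h (f * scalar r) = lin h f * scalar r"
proof (induction rule: single_induct[where f = f])
  case (single w s)
  have "Poly_Mapping.single w s * scalar r = Poly_Mapping.single w (s * r)"
    by (simp add: scalar_def mult_single_list)
  then show ?case by (simp add: scalar_mult mult.assoc)
qed (simp_all add: distrib_right)

lemma keys_mult_list:
  "Poly_Mapping.keys (f * g) \<subseteq> {v @ w | v w. v \<in> Poly_Mapping.keys f \<and> w \<in> Poly_Mapping.keys g}"
  using keys_mult[of f g] by (simp add: plus_list_def)

lemma keys_scalar: "Poly_Mapping.keys (f * scalar r) \<subseteq> Poly_Mapping.keys f"
  using keys_mult_list[of f "scalar r"] by (auto simp: scalar_def split: if_splits)

lemma keys_lin: "Poly_Mapping.keys (lin h f) \<subseteq> (\<Union>w\<in>Poly_Mapping.keys f. Poly_Mapping.keys (h w))"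
proof -
  have "Poly_Mapping.keys (lin h f)
    \<subseteq> (\<Union>w\<in>Poly_Mapping.keys f. Poly_Mapping.keys (h w * scalar (Poly_Mapping.lookup f w)))"
    unfolding lin_def by (rule keys_sum)
  then show ?thesis using keys_scalar by fastforce
qed


section \<open>The defining ideal\<close>

text \<open>Additive inverses come from the coefficient \<open>- 1\<close>, so sums and coefficients
  together already yield a subgroup.\<close>

lemma coeff_ideal_iff:
  fixes I :: "('x list \<Rightarrow>\<^sub>0 'r::ring_1) set"
  shows "coeff_ideal I X \<longleftrightarrow>
    I \<subseteq> carrier (free_rng X) \<and> 0 \<in> I \<and> (\<forall>f\<in>I. \<forall>g\<in>I. f + g \<in> I) \<and>
    (\<forall>f\<in>I. \<forall>g\<in>carrier (free_rng X). f * g \<in> I \<and> g * f \<in> I) \<and> (\<forall>r. \<forall>f\<in>I. scalar r * f \<in> I)"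
    (is "_ \<longleftrightarrow> ?R")
proof
  assume "coeff_ideal I X"
  then interpret rng_ideal I "free_rng X"
    by (simp add: coeff_ideal_def)
  show ?R
    using \<open>coeff_ideal I X\<close> a_subset I_l_closed I_r_closed
      additive_subgroup.zero_closed[OF additive_subgroup_axioms]
      additive_subgroup.a_closed[OF additive_subgroup_axioms]
    unfolding free_rng_def coeff_ideal_def map_scale_conv_scalar by simp
next
  assume R: ?R
  let ?F = "free_rng X :: ('x list \<Rightarrow>\<^sub>0 'r) ring"
  interpret F: rng ?F by (rule rng_free_rng)
  have neg: "- f \<in> I" if "f \<in> I" for f
  proof -
    have "scalar (- 1) * f = - f"
      by (simp add: scalar_def single_uminus flip: zero_list_def)
    then show ?thesis using R that by metis
  qed
  have inv: "\<ominus>\<^bsub>?F\<^esub> f = - f" if "f \<in> I" for f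
    using that R neg[OF that] by (intro F.minus_equality) (auto simp: free_rng_def)
  have "subgroup I (add_monoid ?F)"
    using R neg inv
    by (intro F.add.subgroupI) (auto simp: free_rng_def a_inv_def)
  then show "coeff_ideal I X"
    using R unfolding coeff_ideal_def
    by (intro conjI rng_ideal.intro rng_ideal_axioms.intro additive_subgroup.intro)
      (auto simp: F.rng_axioms map_scale_conv_scalar free_rng_def intro: F.rng_axioms[unfolded free_rng_def])
qed

text \<open>Centrality is meant with respect to coefficients only. Words have it over every
  coefficient ring, and so do the relations, whose coefficients are integers.\<close>

definition central :: "('x list \<Rightarrow>\<^sub>0 'r::ring_1) \<Rightarrow> bool" where
  "central f \<longleftrightarrow> (\<forall>r. scalar r * f = f * scalar r)"

lemma central_intros [intro, simp]:
  "central 0" "central (letter x)" "central (word w)"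
  "central f \<Longrightarrow> central g \<Longrightarrow> central (f + g)"
  "central f \<Longrightarrow> central g \<Longrightarrow> central (f - g)"
  by (simp_all add: central_def letter_def scalar_def mult_single_list distrib_left distrib_right
        left_diff_distrib right_diff_distrib)

lemma central_mult [intro, simp]: "central f \<Longrightarrow> central g \<Longrightarrow> central (f * g)"
  unfolding central_def by (metis mult.assoc)

lemma central_sum: "(\<And>a. a \<in> A \<Longrightarrow> central (f a)) \<Longrightarrow> central (sum f A)"
  by (induction A rule: infinite_finite_induct) auto

lemma carrier_free_rng: "f \<in> carrier (free_rng X) \<longleftrightarrow> Poly_Mapping.keys f \<subseteq> lists X - {[]}"
  by (simp add: free_rng_def)

lemma free_rng_mult_scalar:
  "f \<in> carrier (free_rng X) \<Longrightarrow> f * scalar r \<in> carrier (free_rng X)"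
  using keys_scalar unfolding carrier_free_rng by blast

text \<open>
  Left coefficients are built into the ideal; closure under right coefficients holds because the
  generators commute with coefficients.
\<close>

lemma gen_coeff_ideal_scalar_right:
  assumes "S \<subseteq> carrier (free_rng X)" "\<And>s. s \<in> S \<Longrightarrow> central s" "f \<in> gen_coeff_ideal X S"
  shows "f * scalar r \<in> gen_coeff_ideal X S"
proof -
  let ?I = "gen_coeff_ideal X S"
  define J where "J = {f \<in> ?I. \<forall>r. f * scalar r \<in> ?I}"
  have I: "coeff_ideal ?I X" using coeff_ideal_gen_coeff_ideal assms(1) .
  have S: "S \<subseteq> ?I" by (auto simp: gen_coeff_ideal_def)
  have "coeff_ideal J X"
    unfolding coeff_ideal_iff
    using I[unfolded coeff_ideal_iff]
    by (auto simp: J_def distrib_right mult.assoc free_rng_mult_scalar)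
  moreover have "S \<subseteq> J"
  proof
    fix s assume "s \<in> S"
    moreover have "scalar r * s \<in> ?I" for r
      using S I \<open>s \<in> S\<close> unfolding coeff_ideal_iff by blast
    ultimately show "s \<in> J"
      using S assms(2)[of s] by (auto simp: J_def central_def)
  qed
  ultimately have "?I \<subseteq> J" by (auto simp: gen_coeff_ideal_def)
  then show ?thesis using assms(3) by (auto simp: J_def)
qed

lemma gen_coeff_ideal_subset:
  "coeff_ideal J X \<Longrightarrow> S \<subseteq> J \<Longrightarrow> gen_coeff_ideal X S \<subseteq> J"
  by (auto simp: gen_coeff_ideal_def)

section \<open>Computing modulo the defining ideal\<close>

lemma free_rng_closed [simp]:
  fixes f g :: "'x list \<Rightarrow>\<^sub>0 'r::ring_1"
  shows "0 \<in> carrier (free_rng X)"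
    and "f \<in> carrier (free_rng X) \<Longrightarrow> g \<in> carrier (free_rng X) \<Longrightarrow> f + g \<in> carrier (free_rng X)"
    and "f \<in> carrier (free_rng X) \<Longrightarrow> g \<in> carrier (free_rng X) \<Longrightarrow> f * g \<in> carrier (free_rng X)"
    and "f \<in> carrier (free_rng X) \<Longrightarrow> scalar r * f \<in> carrier (free_rng X)"
    and "letter x \<in> carrier (free_rng X) \<longleftrightarrow> x \<in> X"
  using coeff_ideal_carrier[of X, where 'r='r] unfolding coeff_ideal_iff
  by (simp_all add: carrier_free_rng letter_def)

context weighted_graph
begin

abbreviation wlpa_ideal :: "(('v, 'e) symbol list \<Rightarrow>\<^sub>0 'r::ring_1) set" where
  "wlpa_ideal \<equiv> gen_coeff_ideal (symbols E \<omega>) (wlpa_relations E \<omega>)"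

abbreviation free_carrier :: "(('v, 'e) symbol list \<Rightarrow>\<^sub>0 'r::ring_1) set" where
  "free_carrier \<equiv> carrier (free_rng (symbols E \<omega>))"

lemma finite_out_arcs: "finite (out_arcs E v)"
  using row_finite[of v] by (cases "v \<in> verts E") (auto simp: out_arcs_def intro: rev_finite_subset[OF finite.emptyI])

text \<open>The convention that letters of too large index vanish turns into a condition on the
  summation range. This is the form in which double sums can later be interchanged.\<close>

lemma edge_ghost_sum:
  "(\<Sum>\<alpha>\<in>out_arcs E v. edge_elt \<omega> \<alpha> i * ghost_elt \<omega> \<alpha> j)
    = (\<Sum>\<alpha> | \<alpha> \<in> out_arcs E v \<and> i \<le> \<omega> \<alpha> \<and> j \<le> \<omega> \<alpha>. letter (Edge \<alpha> i) * letter (Ghost \<alpha> j))"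
  by (rule sum.mono_neutral_cong_right)
    (use finite_out_arcs in \<open>auto simp: edge_elt_def ghost_elt_def\<close>)

lemma ghost_edge_sum:
  "(\<Sum>i = 1..max (\<omega> \<alpha>) (\<omega> \<beta>). ghost_elt \<omega> \<alpha> i * edge_elt \<omega> \<beta> i)
    = (\<Sum>i = 1..min (\<omega> \<alpha>) (\<omega> \<beta>). letter (Ghost \<alpha> i) * letter (Edge \<beta> i))"
  by (rule sum.mono_neutral_cong_right) (auto simp: edge_elt_def ghost_elt_def)

lemma wlpa_relations_cases:
  fixes s :: "('v, 'e) symbol list \<Rightarrow>\<^sub>0 'r::ring_1"
  assumes "s \<in> wlpa_relations E \<omega>"
  obtains v w where "v \<in> verts E" "w \<in> verts E"
      "s = letter (Vertex v) * letter (Vertex w) - (if v = w then letter (Vertex v) else 0)"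
    | x where "x \<in> edges E \<omega> \<union> ghosts E \<omega>" "s = letter (Vertex (source E x)) * letter x - letter x"
    | x where "x \<in> edges E \<omega> \<union> ghosts E \<omega>" "s = letter x * letter (Vertex (target E x)) - letter x"
    | v i j where "v \<in> verts E" "out_arcs E v \<noteq> {}"
      "i \<in> {1..vertex_weight E \<omega> v}" "j \<in> {1..vertex_weight E \<omega> v}"
      "s = (\<Sum>\<alpha> | \<alpha> \<in> out_arcs E v \<and> i \<le> \<omega> \<alpha> \<and> j \<le> \<omega> \<alpha>. letter (Edge \<alpha> i) * letter (Ghost \<alpha> j))
        - (if i = j then letter (Vertex v) else 0)"
    | \<alpha> \<beta> where "\<alpha> \<in> arcs E" "\<beta> \<in> arcs E"
      "s = (\<Sum>i = 1..min (\<omega> \<alpha>) (\<omega> \<beta>). letter (Ghost \<alpha> i) * letter (Edge \<beta> i))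
        - (if \<alpha> = \<beta> then letter (Vertex (head E \<alpha>)) else 0)"
proof -
  have "Edge \<alpha> i \<in> edges E \<omega> \<union> ghosts E \<omega>" "Ghost \<alpha> i \<in> edges E \<omega> \<union> ghosts E \<omega>"
    "edge_elt \<omega> \<alpha> i = (letter (Edge \<alpha> i) :: ('v, 'e) symbol list \<Rightarrow>\<^sub>0 'r)"
    "ghost_elt \<omega> \<alpha> i = (letter (Ghost \<alpha> i) :: ('v, 'e) symbol list \<Rightarrow>\<^sub>0 'r)"
    if "\<alpha> \<in> arcs E" "i \<in> {1..\<omega> \<alpha>}" for \<alpha> i
    using that by (auto simp: edges_def ghosts_def edge_elt_def ghost_elt_def)
  note letters = this
  from assms show thesis
    unfolding wlpa_relations_def vertex_elt_def
  proof (elim UnE, goal_cases)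
    case 1
    then obtain v w where "v \<in> verts E" "w \<in> verts E"
      "s = letter (Vertex v) * letter (Vertex w) - (if v = w then letter (Vertex v) else 0)"
      unfolding mem_Collect_eq by metis
    then show ?case by (rule that(1))
  next
    case 2
    then obtain \<alpha> i where "\<alpha> \<in> arcs E" "i \<in> {1..\<omega> \<alpha>}"
      "s = letter (Vertex (tail E \<alpha>)) * edge_elt \<omega> \<alpha> i - edge_elt \<omega> \<alpha> i"
      unfolding mem_Collect_eq by metis
    then show ?case using letters[of \<alpha> i] by (intro that(2)[of "Edge \<alpha> i"]) simp_all
  next
    case 3
    then obtain \<alpha> i where "\<alpha> \<in> arcs E" "i \<in> {1..\<omega> \<alpha>}"
      "s = edge_elt \<omega> \<alpha> i * letter (Vertex (head E \<alpha>)) - edge_elt \<omega> \<alpha> i"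
      unfolding mem_Collect_eq by metis
    then show ?case using letters[of \<alpha> i] by (intro that(3)[of "Edge \<alpha> i"]) simp_all
  next
    case 4
    then obtain \<alpha> i where "\<alpha> \<in> arcs E" "i \<in> {1..\<omega> \<alpha>}"
      "s = letter (Vertex (head E \<alpha>)) * ghost_elt \<omega> \<alpha> i - ghost_elt \<omega> \<alpha> i"
      unfolding mem_Collect_eq by metis
    then show ?case using letters[of \<alpha> i] by (intro that(2)[of "Ghost \<alpha> i"]) simp_all
  next
    case 5
    then obtain \<alpha> i where "\<alpha> \<in> arcs E" "i \<in> {1..\<omega> \<alpha>}"
      "s = ghost_elt \<omega> \<alpha> i * letter (Vertex (tail E \<alpha>)) - ghost_elt \<omega> \<alpha> i"
      unfolding mem_Collect_eq by metis
    then show ?case using letters[of \<alpha> i] by (intro that(3)[of "Ghost \<alpha> i"]) simp_all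
  next
    case 6
    then obtain v i j where "v \<in> verts E" "out_arcs E v \<noteq> {}"
      "i \<in> {1..vertex_weight E \<omega> v}" "j \<in> {1..vertex_weight E \<omega> v}"
      "s = (\<Sum>\<alpha>\<in>out_arcs E v. edge_elt \<omega> \<alpha> i * ghost_elt \<omega> \<alpha> j) - (if i = j then letter (Vertex v) else 0)"
      unfolding mem_Collect_eq by (elim exE conjE) (rule that)
    then show ?case unfolding edge_ghost_sum by (rule that(4))
  next
    case 7
    then obtain \<alpha> \<beta> where "\<alpha> \<in> arcs E" "\<beta> \<in> arcs E"
      "s = (\<Sum>i = 1..max (\<omega> \<alpha>) (\<omega> \<beta>). ghost_elt \<omega> \<alpha> i * edge_elt \<omega> \<beta> i)
        - (if \<alpha> = \<beta> then letter (Vertex (head E \<alpha>)) else 0)"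
      unfolding mem_Collect_eq by (elim exE conjE) (rule that)
    then show ?case unfolding ghost_edge_sum by (rule that(5))
  qed
qed

lemma central_relations: "s \<in> wlpa_relations E \<omega> \<Longrightarrow> central s"
  by (erule wlpa_relations_cases) (simp_all add: central_sum)

lemma wlpa_ideal_coeff_ideal:
  "coeff_ideal (wlpa_ideal :: (('v, 'e) symbol list \<Rightarrow>\<^sub>0 'r::ring_1) set) (symbols E \<omega>)"
  by (rule coeff_ideal_gen_coeff_ideal[OF wlpa_relations_subset])

lemma wlpa_ideal_closed:
  fixes f g s :: "('v, 'e) symbol list \<Rightarrow>\<^sub>0 'r::ring_1"
  shows "(0 :: _ \<Rightarrow>\<^sub>0 'r) \<in> wlpa_ideal"
    and "f \<in> wlpa_ideal \<Longrightarrow> g \<in> wlpa_ideal \<Longrightarrow> f + g \<in> wlpa_ideal"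
    and "f \<in> wlpa_ideal \<Longrightarrow> g \<in> free_carrier \<Longrightarrow> f * g \<in> wlpa_ideal"
    and "f \<in> wlpa_ideal \<Longrightarrow> g \<in> free_carrier \<Longrightarrow> g * f \<in> wlpa_ideal"
    and "f \<in> wlpa_ideal \<Longrightarrow> scalar r * f \<in> wlpa_ideal"
    and "f \<in> wlpa_ideal \<Longrightarrow> f * scalar r \<in> wlpa_ideal"
    and "f \<in> wlpa_ideal \<Longrightarrow> f \<in> free_carrier"
    and "s \<in> wlpa_relations E \<omega> \<Longrightarrow> s \<in> wlpa_ideal"
proof -
  note I = wlpa_ideal_coeff_ideal[where 'r='r, unfolded coeff_ideal_iff]
  show "(0 :: _ \<Rightarrow>\<^sub>0 'r) \<in> wlpa_ideal" using I by simp
  show "f \<in> wlpa_ideal \<Longrightarrow> g \<in> wlpa_ideal \<Longrightarrow> f + g \<in> wlpa_ideal" using I by simp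
  show "f \<in> wlpa_ideal \<Longrightarrow> g \<in> free_carrier \<Longrightarrow> f * g \<in> wlpa_ideal" using I by simp
  show "f \<in> wlpa_ideal \<Longrightarrow> g \<in> free_carrier \<Longrightarrow> g * f \<in> wlpa_ideal" using I by simp
  show "f \<in> wlpa_ideal \<Longrightarrow> scalar r * f \<in> wlpa_ideal" using I by simp
  show "f \<in> wlpa_ideal \<Longrightarrow> f * scalar r \<in> wlpa_ideal"
    by (rule gen_coeff_ideal_scalar_right[OF wlpa_relations_subset central_relations])
  show "f \<in> wlpa_ideal \<Longrightarrow> f \<in> free_carrier" using I by blast
  show "s \<in> wlpa_relations E \<omega> \<Longrightarrow> s \<in> wlpa_ideal" by (auto simp: gen_coeff_ideal_def)
qed

lemma wlpa_relations_intros: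
  shows "v \<in> verts E \<Longrightarrow> w \<in> verts E \<Longrightarrow>
      letter (Vertex v) * letter (Vertex w) - (if v = w then letter (Vertex v) else 0)
        \<in> wlpa_relations E \<omega>" (is "_ \<Longrightarrow> _ \<Longrightarrow> ?vertex \<in> _")
    and "x \<in> edges E \<omega> \<union> ghosts E \<omega> \<Longrightarrow>
      letter (Vertex (source E x)) * letter x - letter x \<in> wlpa_relations E \<omega>"
    and "x \<in> edges E \<omega> \<union> ghosts E \<omega> \<Longrightarrow>
      letter x * letter (Vertex (target E x)) - letter x \<in> wlpa_relations E \<omega>"
    and "v \<in> verts E \<Longrightarrow> out_arcs E v \<noteq> {} \<Longrightarrow>
      i \<in> {1..vertex_weight E \<omega> v} \<Longrightarrow> j \<in> {1..vertex_weight E \<omega> v} \<Longrightarrow>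
      (\<Sum>\<alpha> | \<alpha> \<in> out_arcs E v \<and> i \<le> \<omega> \<alpha> \<and> j \<le> \<omega> \<alpha>. letter (Edge \<alpha> i) * letter (Ghost \<alpha> j))
        - (if i = j then letter (Vertex v) else 0) \<in> wlpa_relations E \<omega>"
    and "\<alpha> \<in> arcs E \<Longrightarrow> \<beta> \<in> arcs E \<Longrightarrow>
      (\<Sum>i = 1..min (\<omega> \<alpha>) (\<omega> \<beta>). letter (Ghost \<alpha> i) * letter (Edge \<beta> i))
        - (if \<alpha> = \<beta> then letter (Vertex (head E \<alpha>)) else 0) \<in> wlpa_relations E \<omega>"
proof -
  note defs = wlpa_relations_def vertex_elt_def
  show "v \<in> verts E \<Longrightarrow> w \<in> verts E \<Longrightarrow> ?vertex \<in> wlpa_relations E \<omega>"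
    unfolding defs by ((rule UnI1)+, rule CollectI, rule exI[of _ v], rule exI[of _ w], intro conjI refl)
  show "letter (Vertex (source E x)) * letter x - letter x \<in> wlpa_relations E \<omega>"
    "letter x * letter (Vertex (target E x)) - letter x \<in> wlpa_relations E \<omega>"
    if x: "x \<in> edges E \<omega> \<union> ghosts E \<omega>"
  proof -
    from x consider (edge) \<alpha> i where "\<alpha> \<in> arcs E" "i \<in> {1..\<omega> \<alpha>}" "x = Edge \<alpha> i"
      | (ghost) \<alpha> i where "\<alpha> \<in> arcs E" "i \<in> {1..\<omega> \<alpha>}" "x = Ghost \<alpha> i"
      by (auto simp: edges_def ghosts_def)
    then have "letter (Vertex (source E x)) * letter x - letter x \<in> wlpa_relations E \<omega> \<and>
      letter x * letter (Vertex (target E x)) - letter x \<in> wlpa_relations E \<omega>"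
    proof cases
      case (edge \<alpha> i)
      have x: "letter x = edge_elt \<omega> \<alpha> i" "source E x = tail E \<alpha>" "target E x = head E \<alpha>"
        using edge by (simp_all add: edge_elt_def)
      show ?thesis
        unfolding defs x
        proof (rule conjI, goal_cases)
        case 1
        show ?case by ((rule UnI1, rule UnI1, rule UnI1, rule UnI1, rule UnI1, rule UnI2,
            rule CollectI, rule exI[of _ \<alpha>], rule exI[of _ i]), intro conjI refl edge(1,2))
      next
        case 2
        show ?case by ((rule UnI1, rule UnI1, rule UnI1, rule UnI1, rule UnI2,
            rule CollectI, rule exI[of _ \<alpha>], rule exI[of _ i]), intro conjI refl edge(1,2))
      qed
    next
      case (ghost \<alpha> i)
      have x: "letter x = ghost_elt \<omega> \<alpha> i" "source E x = head E \<alpha>" "target E x = tail E \<alpha>"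
        using ghost by (simp_all add: ghost_elt_def)
      show ?thesis
        unfolding defs x
        proof (rule conjI, goal_cases)
        case 1
        show ?case by ((rule UnI1, rule UnI1, rule UnI1, rule UnI2,
            rule CollectI, rule exI[of _ \<alpha>], rule exI[of _ i]), intro conjI refl ghost(1,2))
      next
        case 2
        show ?case by ((rule UnI1, rule UnI1, rule UnI2,
            rule CollectI, rule exI[of _ \<alpha>], rule exI[of _ i]), intro conjI refl ghost(1,2))
      qed
    qed
    then show "letter (Vertex (source E x)) * letter x - letter x \<in> wlpa_relations E \<omega>"
      "letter x * letter (Vertex (target E x)) - letter x \<in> wlpa_relations E \<omega>"
      by blast+
  qed
  show "v \<in> verts E \<Longrightarrow> out_arcs E v \<noteq> {} \<Longrightarrow>
      i \<in> {1..vertex_weight E \<omega> v} \<Longrightarrow> j \<in> {1..vertex_weight E \<omega> v} \<Longrightarrow>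
      (\<Sum>\<alpha> | \<alpha> \<in> out_arcs E v \<and> i \<le> \<omega> \<alpha> \<and> j \<le> \<omega> \<alpha>. letter (Edge \<alpha> i) * letter (Ghost \<alpha> j))
        - (if i = j then letter (Vertex v) else 0) \<in> wlpa_relations E \<omega>"
    unfolding defs edge_ghost_sum[symmetric]
    by (rule UnI1, rule UnI2, rule CollectI, rule exI[of _ v], rule exI[of _ i], rule exI[of _ j],
      intro conjI refl)
  show "\<alpha> \<in> arcs E \<Longrightarrow> \<beta> \<in> arcs E \<Longrightarrow>
      (\<Sum>i = 1..min (\<omega> \<alpha>) (\<omega> \<beta>). letter (Ghost \<alpha> i) * letter (Edge \<beta> i))
        - (if \<alpha> = \<beta> then letter (Vertex (head E \<alpha>)) else 0) \<in> wlpa_relations E \<omega>"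
    unfolding defs ghost_edge_sum[symmetric]
    by (rule UnI2, rule CollectI, rule exI[of _ \<alpha>], rule exI[of _ \<beta>], intro conjI refl)
qed

lemma source_target_verts: "x \<in> symbols E \<omega> \<Longrightarrow> source E x \<in> verts E \<and> target E x \<in> verts E"
  by (auto simp: symbols_def edges_def ghosts_def)

lemma vertex_symbol [simp]: "Vertex v \<in> symbols E \<omega> \<longleftrightarrow> v \<in> verts E"
  by (auto simp: symbols_def edges_def ghosts_def)

lemma wlpa_ideal_uminus: "f \<in> wlpa_ideal \<Longrightarrow> - f \<in> wlpa_ideal"
  using wlpa_ideal_closed(5)[of f "- 1"]
  by (simp add: scalar_def single_uminus flip: zero_list_def)

lemma wlpa_ideal_diff: "f \<in> wlpa_ideal \<Longrightarrow> g \<in> wlpa_ideal \<Longrightarrow> f - g \<in> wlpa_ideal"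
  using wlpa_ideal_closed(2)[of f "- g"] wlpa_ideal_uminus[of g] by simp

lemma wlpa_ideal_sum: "(\<And>a. a \<in> A \<Longrightarrow> f a \<in> wlpa_ideal) \<Longrightarrow> sum f A \<in> wlpa_ideal"
  by (induction A rule: infinite_finite_induct) (auto intro: wlpa_ideal_closed)

lemma wlpa_ideal_cong: "f - g \<in> wlpa_ideal \<Longrightarrow> f \<in> wlpa_ideal \<longleftrightarrow> g \<in> wlpa_ideal"
  using wlpa_ideal_closed(2)[of "f - g" g] wlpa_ideal_diff[of f "f - g"] by auto

lemma wlpa_ideal_trans: "f - g \<in> wlpa_ideal \<Longrightarrow> g - h \<in> wlpa_ideal \<Longrightarrow> f - h \<in> wlpa_ideal"
  using wlpa_ideal_closed(2)[of "f - g" "g - h"] by simp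

lemma wlpa_ideal_word:
  assumes "w \<in> lists (symbols E \<omega>)" "f \<in> wlpa_ideal"
  shows "word w * f \<in> wlpa_ideal" "f * word w \<in> wlpa_ideal"
  using assms wlpa_ideal_closed(3,4)[OF assms(2), of "word w"]
  by (cases "w = []"; simp add: carrier_free_rng flip: zero_list_def)+

section \<open>Vertices as local units\<close>

lemma source_mult:
  assumes "x \<in> symbols E \<omega>"
  shows "letter (Vertex (source E x)) * letter x - letter x \<in> wlpa_ideal"
proof (cases "x \<in> edges E \<omega> \<union> ghosts E \<omega>")
  case True
  then show ?thesis by (intro wlpa_ideal_closed(8) wlpa_relations_intros(2))
next
  case False
  with assms obtain v where "v \<in> verts E" "x = Vertex v" by (auto simp: symbols_def)
  then show ?thesis
    using wlpa_ideal_closed(8)[OF wlpa_relations_intros(1)[of v v]] by simp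
qed

lemma target_mult:
  assumes "x \<in> symbols E \<omega>"
  shows "letter x * letter (Vertex (target E x)) - letter x \<in> wlpa_ideal"
proof (cases "x \<in> edges E \<omega> \<union> ghosts E \<omega>")
  case True
  then show ?thesis by (intro wlpa_ideal_closed(8) wlpa_relations_intros(3))
next
  case False
  with assms obtain v where "v \<in> verts E" "x = Vertex v" by (auto simp: symbols_def)
  then show ?thesis
    using wlpa_ideal_closed(8)[OF wlpa_relations_intros(1)[of v v]] by simp
qed

text \<open>Modulo the ideal, the vertex at the end of \<open>x\<close> and the vertex at the
  beginning of \<open>y\<close> can be inserted between them, and different vertices are
  orthogonal.\<close>

lemma mult_mismatch:
  fixes x y
  assumes "x \<in> symbols E \<omega>" "y \<in> symbols E \<omega>" "target E x \<noteq> source E y"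
  shows "letter x * letter y \<in> (wlpa_ideal :: (_ \<Rightarrow>\<^sub>0 'r::ring_1) set)"
proof -
  let ?t = "letter (Vertex (target E x)) :: _ \<Rightarrow>\<^sub>0 'r" and ?s = "letter (Vertex (source E y)) :: _ \<Rightarrow>\<^sub>0 'r"
  let ?x = "letter x :: _ \<Rightarrow>\<^sub>0 'r" and ?y = "letter y :: _ \<Rightarrow>\<^sub>0 'r"
  have c: "?x \<in> free_carrier" "?y \<in> free_carrier" "?s \<in> free_carrier"
    using assms source_target_verts by simp_all
  have "?t * ?s \<in> wlpa_ideal"
    using wlpa_relations_intros(1)[of "target E x" "source E y"] source_target_verts assms
    by (auto intro: wlpa_ideal_closed(8))
  then have 1: "?x * (?t * ?s) * ?y \<in> wlpa_ideal"
    using c wlpa_ideal_closed(3,4) by blast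
  have 2: "(?x * ?t - ?x) * (?s * ?y) \<in> wlpa_ideal"
    by (rule wlpa_ideal_closed(3)[OF target_mult[OF assms(1)] free_rng_closed(3)[OF c(3,2)]])
  have 3: "?x * (?s * ?y - ?y) \<in> wlpa_ideal"
    by (rule wlpa_ideal_closed(4)[OF source_mult[OF assms(2)] c(1)])
  have "?x * ?y = ?x * (?t * ?s) * ?y - (?x * ?t - ?x) * (?s * ?y) - ?x * (?s * ?y - ?y)"
    by (simp add: algebra_simps)
  then show ?thesis using wlpa_ideal_diff[OF wlpa_ideal_diff[OF 1 2] 3] by simp
qed

text \<open>Only the outermost letter of a word matters: its own vertex fixes it modulo the ideal,
  and every other vertex of \<open>U\<close> annihilates it.\<close>

lemma local_unit:
  fixes f :: "('v, 'e) symbol list \<Rightarrow>\<^sub>0 'r::ring_1"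
  assumes "f \<in> free_carrier" "finite U" "U \<subseteq> verts E"
  shows "source E ` hd ` Poly_Mapping.keys f \<subseteq> U \<Longrightarrow> f - (\<Sum>u\<in>U. letter (Vertex u) * f) \<in> wlpa_ideal"
    and "target E ` last ` Poly_Mapping.keys f \<subseteq> U \<Longrightarrow> f - (\<Sum>u\<in>U. f * letter (Vertex u)) \<in> wlpa_ideal"
proof -
  let ?V = "\<lambda>u. letter (Vertex u) :: _ \<Rightarrow>\<^sub>0 'r"
  have left: "letter y - (\<Sum>u\<in>U. ?V u * letter y) \<in> wlpa_ideal"
    if "y \<in> symbols E \<omega>" "source E y \<in> U" for y
  proof -
    have "(?V (source E y) * letter y - letter y) + (\<Sum>u\<in>U - {source E y}. ?V u * letter y) \<in> wlpa_ideal"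
      using that assms(3)
      by (intro wlpa_ideal_closed(2) wlpa_ideal_sum mult_mismatch source_mult) auto
    then have "- (letter y - (\<Sum>u\<in>U. ?V u * letter y)) \<in> wlpa_ideal"
      using that assms(2) by (simp add: sum.remove algebra_simps)
    then show ?thesis using wlpa_ideal_uminus by fastforce
  qed
  have right: "letter y - (\<Sum>u\<in>U. letter y * ?V u) \<in> wlpa_ideal"
    if "y \<in> symbols E \<omega>" "target E y \<in> U" for y
  proof -
    have "(letter y * ?V (target E y) - letter y) + (\<Sum>u\<in>U - {target E y}. letter y * ?V u) \<in> wlpa_ideal"
      using that assms(3)
      by (intro wlpa_ideal_closed(2) wlpa_ideal_sum mult_mismatch target_mult) auto
    then have "- (letter y - (\<Sum>u\<in>U. letter y * ?V u)) \<in> wlpa_ideal"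
      using that assms(2) by (simp add: sum.remove algebra_simps)
    then show ?thesis using wlpa_ideal_uminus by fastforce
  qed
  have w: "w \<noteq> []" "w \<in> lists (symbols E \<omega>)" if "w \<in> Poly_Mapping.keys f" for w
    using assms(1) that by (auto simp: carrier_free_rng)
  show "f - (\<Sum>u\<in>U. ?V u * f) \<in> wlpa_ideal" if U: "source E ` hd ` Poly_Mapping.keys f \<subseteq> U"
  proof (induction rule: single_induct[where f = f])
    case (single w r)
    obtain y w' where yw: "w = y # w'" using w[OF single] by (cases w) auto
    \<comment> \<open>The coefficient is moved to the end of the word that is not multiplied by
      vertices; closure of the ideal under coefficients on both sides permits this.\<close>
    have eq: "(Poly_Mapping.single w r :: _ \<Rightarrow>\<^sub>0 'r) = letter y * word w' * scalar r"
      by (simp add: yw letter_def mult_single_list scalar_def)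
    have "(letter y - (\<Sum>u\<in>U. ?V u * letter y)) * word w' * scalar r \<in> wlpa_ideal"
      using w[OF single] single U yw
      by (intro wlpa_ideal_closed(6) wlpa_ideal_word(2) left) force+
    then show ?case by (simp add: eq left_diff_distrib sum_distrib_right mult.assoc)
  next
    case (add f g)
    then show ?case using wlpa_ideal_closed(2) by (fastforce simp: distrib_left sum.distrib add_diff_add)
  qed (simp add: wlpa_ideal_closed(1))
  show "f - (\<Sum>u\<in>U. f * ?V u) \<in> wlpa_ideal" if U: "target E ` last ` Poly_Mapping.keys f \<subseteq> U"
  proof (induction rule: single_induct[where f = f])
    case (single w r)
    obtain y w' where yw: "w = w' @ [y]" using w[OF single] by (cases w rule: rev_cases) auto
    have eq: "(Poly_Mapping.single w r :: _ \<Rightarrow>\<^sub>0 'r) = scalar r * (word w' * letter y)"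
      by (simp add: yw letter_def mult_single_list scalar_def)
    have "scalar r * (word w' * (letter y - (\<Sum>u\<in>U. letter y * ?V u))) \<in> wlpa_ideal"
      using w[OF single] single U yw
      by (intro wlpa_ideal_closed(5) wlpa_ideal_word(1) right) force+
    then show ?case by (simp add: eq right_diff_distrib sum_distrib_left mult.assoc)
  next
    case (add f g)
    then show ?case using wlpa_ideal_closed(2) by (fastforce simp: distrib_right sum.distrib add_diff_add)
  qed (simp add: wlpa_ideal_closed(1))
qed

text \<open>The graph may have infinitely many vertices, but those at the ends of the words in the
  support of \<open>f\<close> form a finite local unit; if all products with them were in the ideal,
  so would be their sum, and hence \<open>f\<close>.\<close>

lemma ex_vertex_mult:
  fixes f :: "('v, 'e) symbol list \<Rightarrow>\<^sub>0 'r::ring_1"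
  assumes "f \<in> free_carrier" "f \<notin> wlpa_ideal"
  shows "\<exists>u\<in>verts E. letter (Vertex u) * f \<notin> wlpa_ideal"
    and "\<exists>v\<in>verts E. f * letter (Vertex v) \<notin> wlpa_ideal"
proof -
  have w: "source E (hd w) \<in> verts E" "target E (last w) \<in> verts E" if "w \<in> Poly_Mapping.keys f" for w
  proof -
    have "w \<in> lists (symbols E \<omega>)" "w \<noteq> []"
      using assms(1) that by (auto simp: carrier_free_rng)
    then show "source E (hd w) \<in> verts E" "target E (last w) \<in> verts E"
      using source_target_verts[of "hd w"] source_target_verts[of "last w"] by auto
  qed
  show "\<exists>u\<in>verts E. letter (Vertex u) * f \<notin> wlpa_ideal"
  proof (rule ccontr)
    assume *: "\<not> ?thesis"
    let ?U = "source E ` hd ` Poly_Mapping.keys f"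
    have U: "?U \<subseteq> verts E" using w by auto
    then have "(\<Sum>u\<in>?U. letter (Vertex u) * f) \<in> wlpa_ideal"
      using * by (intro wlpa_ideal_sum) blast
    with local_unit(1)[OF assms(1) _ U] show False
      using wlpa_ideal_cong assms(2) by (metis finite_imageI finite_keys order_refl)
  qed
  show "\<exists>v\<in>verts E. f * letter (Vertex v) \<notin> wlpa_ideal"
  proof (rule ccontr)
    assume *: "\<not> ?thesis"
    let ?U = "target E ` last ` Poly_Mapping.keys f"
    have U: "?U \<subseteq> verts E" using w by auto
    then have "(\<Sum>u\<in>?U. f * letter (Vertex u)) \<in> wlpa_ideal"
      using * by (intro wlpa_ideal_sum) blast
    with local_unit(2)[OF assms(1) _ U] show False
      using wlpa_ideal_cong assms(2) by (metis finite_imageI finite_keys order_refl)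
  qed
qed

lemma symbols_cases:
  assumes "y \<in> symbols E \<omega>"
  obtains v where "v \<in> verts E" "y = Vertex v"
    | \<alpha> i where "\<alpha> \<in> arcs E" "1 \<le> i" "i \<le> \<omega> \<alpha>" "y = Edge \<alpha> i"
    | \<alpha> i where "\<alpha> \<in> arcs E" "1 \<le> i" "i \<le> \<omega> \<alpha>" "y = Ghost \<alpha> i"
  using assms by (auto simp: symbols_def edges_def ghosts_def)

lemma edges_iff [simp]:
  "Edge \<alpha> i \<in> edges E \<omega> \<longleftrightarrow> \<alpha> \<in> arcs E \<and> 1 \<le> i \<and> i \<le> \<omega> \<alpha>"
  "Ghost \<alpha> i \<notin> edges E \<omega>" "Vertex v \<notin> edges E \<omega>"
  "Ghost \<alpha> i \<in> ghosts E \<omega> \<longleftrightarrow> \<alpha> \<in> arcs E \<and> 1 \<le> i \<and> i \<le> \<omega> \<alpha>"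
  "Edge \<alpha> i \<notin> ghosts E \<omega>" "Vertex v \<notin> ghosts E \<omega>"
  by (auto simp: edges_def ghosts_def)

end

section \<open>Rewriting generalised paths\<close>

locale special_arcs = weighted_graph E \<omega>
  for E :: "('v, 'e) pre_digraph" and \<omega> :: "'e \<Rightarrow> nat" +
  fixes sp :: "'v \<Rightarrow> 'e"
  assumes sp_out: "v \<in> verts E \<Longrightarrow> out_arcs E v \<noteq> {} \<Longrightarrow> sp v \<in> out_arcs E v"
    and sp_weight: "v \<in> verts E \<Longrightarrow> out_arcs E v \<noteq> {} \<Longrightarrow> \<omega> (sp v) = vertex_weight E \<omega> v"
begin

lemma weight_le_sp: "\<alpha> \<in> arcs E \<Longrightarrow> \<omega> \<alpha> \<le> \<omega> (sp (tail E \<alpha>))"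
  using sp_weight[of "tail E \<alpha>"] row_finite[of "tail E \<alpha>"]
  by (force simp: vertex_weight_def intro: Max_ge)

text \<open>
  A pair of adjacent symbols is forbidden if relation (3) or (4) is used to eliminate it; \<open>red\<close> is
  what replaces it. The vertex that appears in the relation becomes the empty word \<open>1\<close>, because
  \<open>red\<close> is only multiplied to words that end in this vertex.
\<close>

fun forb :: "('v, 'e) symbol \<Rightarrow> ('v, 'e) symbol \<Rightarrow> bool" where
  "forb (Edge \<alpha> i) (Ghost \<beta> j) \<longleftrightarrow> \<alpha> = \<beta> \<and> sp (tail E \<alpha>) = \<alpha>"
| "forb (Ghost \<alpha> i) (Edge \<beta> j) \<longleftrightarrow> i = 1 \<and> j = 1"
| "forb _ _ \<longleftrightarrow> False"

fun red :: "('v, 'e) symbol \<Rightarrow> ('v, 'e) symbol \<Rightarrow> (('v, 'e) symbol list \<Rightarrow>\<^sub>0 'r::ring_1)" where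
  "red (Edge \<alpha> i) (Ghost \<beta> j) = (if i = j then 1 else 0)
     - (\<Sum>\<gamma> | \<gamma> \<in> out_arcs E (tail E \<alpha>) \<and> \<gamma> \<noteq> \<alpha> \<and> i \<le> \<omega> \<gamma> \<and> j \<le> \<omega> \<gamma>. word [Edge \<gamma> i, Ghost \<gamma> j])"
| "red (Ghost \<alpha> i) (Edge \<beta> j) = (if \<alpha> = \<beta> then 1 else 0)
     - (\<Sum>k = 2..min (\<omega> \<alpha>) (\<omega> \<beta>). word [Ghost \<alpha> k, Edge \<beta> k])"
| "red _ _ = 0"

text \<open>
  Reduced paths carry their initial vertex as first letter, so that paths of length zero need no
  special treatment.
\<close>

inductive good :: "('v, 'e) symbol list \<Rightarrow> bool" where
  good_vertex: "u \<in> verts E \<Longrightarrow> good [Vertex u]"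
| good_snoc: "good p \<Longrightarrow> y \<in> edges E \<omega> \<union> ghosts E \<omega> \<Longrightarrow> target E (last p) = source E y
    \<Longrightarrow> \<not> forb (last p) y \<Longrightarrow> good (p @ [y])"

text \<open>For a reduced \<open>p\<close>, the forbidden case occurs only if \<open>last p\<close>
  is an edge or a ghost. Then \<open>butlast p\<close> is again a reduced path, ending in the vertex
  for which the \<open>1\<close> in \<open>red\<close> stands.\<close>

definition step :: "('v, 'e) symbol \<Rightarrow> ('v, 'e) symbol list \<Rightarrow> (('v, 'e) symbol list \<Rightarrow>\<^sub>0 'r::ring_1)" where
  "step y p =
    (if target E (last p) \<noteq> source E y then 0
     else if y \<in> range Vertex then word p
     else if forb (last p) y then word (butlast p) * red (last p) y
     else word (p @ [y]))"

text \<open>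
  Coefficients are put on the right of the module of reduced paths, since over a noncommutative
  ring only then is \<open>Act m (f * g) = Act (Act m f) g\<close>.
\<close>

definition act :: "('v, 'e) symbol \<Rightarrow> (('v, 'e) symbol list \<Rightarrow>\<^sub>0 'r) \<Rightarrow> (('v, 'e) symbol list \<Rightarrow>\<^sub>0 'r::ring_1)" where
  "act y = lin (step y)"

definition actw :: "('v, 'e) symbol list \<Rightarrow> (('v, 'e) symbol list \<Rightarrow>\<^sub>0 'r) \<Rightarrow> (('v, 'e) symbol list \<Rightarrow>\<^sub>0 'r::ring_1)" where
  "actw w m = foldl (\<lambda>m y. act y m) m w"

definition Act :: "(('v, 'e) symbol list \<Rightarrow>\<^sub>0 'r) \<Rightarrow> (('v, 'e) symbol list \<Rightarrow>\<^sub>0 'r) \<Rightarrow> (('v, 'e) symbol list \<Rightarrow>\<^sub>0 'r::ring_1)" where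
  "Act m f = lin (\<lambda>w. actw w m) f"

lemma act_linear [simp]:
  "act y 0 = 0" "act y (m + m') = act y m + act y m'" "act y (m - m') = act y m - act y m'"
  "act y (m * scalar r) = act y m * scalar r" "act y (sum h A) = (\<Sum>a\<in>A. act y (h a))"
  "act y (word p) = step y p"
  by (simp_all add: act_def)

lemma act_if: "act y (if b then m else m') = (if b then act y m else act y m')"
  by simp

lemma actw_Nil [simp]: "actw [] m = m"
  and actw_Cons [simp]: "actw (y # w) m = actw w (act y m)"
  and actw_append [simp]: "actw (v @ w) m = actw w (actw v m)"
  by (simp_all add: actw_def)

lemma actw_linear [simp]:
  "actw w 0 = 0" "actw w (m + m') = actw w m + actw w m'"
  "actw w (m * scalar r) = actw w m * scalar r"
  by (induction w arbitrary: m m') simp_all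

lemma Act_linear [simp]:
  "Act m 0 = 0" "Act m (f + g) = Act m f + Act m g" "Act m (f - g) = Act m f - Act m g"
  "Act m (sum h A) = (\<Sum>a\<in>A. Act m (h a))" "Act m (f * scalar r) = Act m f * scalar r"
  "Act m (Poly_Mapping.single w r) = actw w m * scalar r"
  "Act m (letter x) = act x m"
  by (simp_all add: Act_def letter_def)

lemma Act_linear_left: "Act 0 f = 0" "Act (m + m') f = Act m f + Act m' f"
  by (simp_all add: Act_def lin_def distrib_right sum.distrib)

lemma Act_mult: "Act m (f * g) = Act (Act m f) g"
proof (induction rule: single_induct[where f = f])
  case (single v r)
  show ?case
  proof (induction rule: single_induct[where f = g])
    case (single w s)
    show ?case by (simp add: mult_single_list scalar_mult mult.assoc)
  qed (simp_all add: distrib_left)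
qed (simp_all add: distrib_right Act_linear_left)

lemma Act_scalar_left: "Act m (scalar r * f) = Act (m * scalar r) f"
  by (simp add: Act_mult) (simp add: scalar_def)

section \<open>Reduced paths are stable under rewriting\<close>

lemma good_not_Nil: "good p \<Longrightarrow> p \<noteq> []"
  by (auto elim: good.cases)

lemma good_snoc_iff:
  assumes "p \<noteq> []"
  shows "good (p @ [y]) \<longleftrightarrow> good p \<and> y \<in> edges E \<omega> \<union> ghosts E \<omega> \<and>
    target E (last p) = source E y \<and> \<not> forb (last p) y"
  using assms by (auto intro: good_snoc elim: good.cases)

lemma good_last_cases:
  assumes "good p" "last p \<notin> range Vertex"
  obtains q x where "p = q @ [x]" "q \<noteq> []" "good q" "x \<in> edges E \<omega> \<union> ghosts E \<omega>"
    "target E (last q) = source E x" "\<not> forb (last q) x"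
  using assms good_not_Nil by (cases rule: good.cases) auto

lemma good_symbols: "good p \<Longrightarrow> p \<in> lists (symbols E \<omega>) - {[]}"
  by (induction rule: good.induct) (auto simp: symbols_def)

text \<open>A single rewriting suffices. The pairs in \<open>red\<close> are not forbidden, because
  the new arc is not special or the new index is at least \<open>2\<close>. The pair formed with the
  preceding letter stays allowed as well: for an edge after a ghost only indices matter, and rule
  (3) keeps the index; for a ghost after an edge only arcs matter, and rule (4) keeps the
  arc.\<close>

lemma step_closed:
  assumes "good p" "y \<in> symbols E \<omega>" "q \<in> Poly_Mapping.keys (step y p :: _ \<Rightarrow>\<^sub>0 'r::ring_1)"
  shows "good q \<and> hd q = hd p \<and> target E (last q) = target E y"
proof (cases "y \<in> range Vertex \<or> \<not> forb (last p) y")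
  case True
  then show ?thesis
    using assms good_not_Nil[OF assms(1)]
    by (auto simp: step_def symbols_def good_snoc_iff split: if_splits)
next
  case False
  then have "last p \<notin> range Vertex" by (cases y) auto
  with assms(1) obtain p' x where p: "p = p' @ [x]" "p' \<noteq> []" "good p'"
      "x \<in> edges E \<omega> \<union> ghosts E \<omega>" "target E (last p') = source E x" "\<not> forb (last p') x"
    by (rule good_last_cases)
  have q: "q \<in> Poly_Mapping.keys (word p' * red x y :: _ \<Rightarrow>\<^sub>0 'r)" "target E x = source E y"
    using assms(3) False by (auto simp: step_def p split: if_splits)
  then obtain w where w: "w \<in> Poly_Mapping.keys (red x y :: _ \<Rightarrow>\<^sub>0 'r)" "q = p' @ w"
    using keys_mult_list by fastforce
  have one: "Poly_Mapping.keys (if b then 1 else 0 :: _ list \<Rightarrow>\<^sub>0 'r) \<subseteq> {[]}" for b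
    by (simp add: zero_list_def)
  consider \<alpha> i j where "x = Edge \<alpha> i" "y = Ghost \<alpha> j" "sp (tail E \<alpha>) = \<alpha>"
    | \<alpha> \<beta> where "x = Ghost \<alpha> 1" "y = Edge \<beta> 1"
    using False p(1) by (cases x; cases y) auto
  then show ?thesis
  proof cases
    case c1: 1
    let ?S = "{\<gamma> \<in> out_arcs E (tail E \<alpha>). \<gamma> \<noteq> \<alpha> \<and> i \<le> \<omega> \<gamma> \<and> j \<le> \<omega> \<gamma>}"
    have "Poly_Mapping.keys (red x y :: _ \<Rightarrow>\<^sub>0 'r) \<subseteq>
      {[]} \<union> (\<Union>\<gamma>\<in>?S. Poly_Mapping.keys (word [Edge \<gamma> i, Ghost \<gamma> j] :: _ \<Rightarrow>\<^sub>0 'r))"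
      unfolding c1 red.simps by (rule order.trans[OF keys_diff Un_mono[OF one keys_sum]])
    then consider "w = []" | \<gamma> where "\<gamma> \<in> ?S" "w = [Edge \<gamma> i, Ghost \<gamma> j]"
      using w(1) by auto
    then show ?thesis
    proof cases
      case 1
      then show ?thesis using p w(2) c1 by simp
    next
      case 2
      have "\<not> forb (last p') (Edge \<gamma> i)"
        using p(6) c1 by (cases "last p'") auto
      then have "good (p' @ [Edge \<gamma> i])"
        using p c1 2 by (auto simp: good_snoc_iff)
      then have "good ((p' @ [Edge \<gamma> i]) @ [Ghost \<gamma> j])"
        using assms(2) c1 2 by (subst good_snoc_iff) (auto simp: symbols_def)
      then show ?thesis using p w(2) c1 2 by simp
    qed
  next
    case c2: 2
    let ?S = "{2..min (\<omega> \<alpha>) (\<omega> \<beta>)}"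
    have "Poly_Mapping.keys (red x y :: _ \<Rightarrow>\<^sub>0 'r) \<subseteq>
      Poly_Mapping.keys (if \<alpha> = \<beta> then 1 else 0 :: _ list \<Rightarrow>\<^sub>0 'r) \<union>
      (\<Union>k\<in>?S. Poly_Mapping.keys (word [Ghost \<alpha> k, Edge \<beta> k] :: _ \<Rightarrow>\<^sub>0 'r))"
      unfolding c2 red.simps by (rule order.trans[OF keys_diff Un_mono[OF order.refl keys_sum]])
    then consider "w = []" "\<alpha> = \<beta>" | k where "k \<in> ?S" "w = [Ghost \<alpha> k, Edge \<beta> k]"
      using w(1) by (auto simp: zero_list_def split: if_splits)
    then show ?thesis
    proof cases
      case 1
      then show ?thesis using 1 p q(2) w(2) c2 by simp
    next
      case k: 2
      have "\<not> forb (last p') (Ghost \<alpha> k)"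
        using p(6) c2 by (cases "last p'") auto
      then have "good (p' @ [Ghost \<alpha> k])"
        using p c2 k by (auto simp: good_snoc_iff)
      then have "good ((p' @ [Ghost \<alpha> k]) @ [Edge \<beta> k])"
        using assms(2) q(2) c2 k by (subst good_snoc_iff) (auto simp: symbols_def)
      then show ?thesis using p w(2) c2 k by simp
    qed
  qed
qed

lemma not_range_Vertex [simp]: "Edge \<alpha> i \<notin> range Vertex" "Ghost \<alpha> i \<notin> range Vertex"
  by auto

lemma good_lastD:
  assumes "good p" "last p = x" "x \<notin> range Vertex"
  shows "\<exists>q. p = q @ [x] \<and> q \<noteq> [] \<and> good q \<and> x \<in> edges E \<omega> \<union> ghosts E \<omega> \<and>
    target E (last q) = source E x \<and> \<not> forb (last q) x"
proof -
  from assms have "last p \<notin> range Vertex" by simp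
  with assms(1) show ?thesis
    by (rule good_last_cases) (use assms(2) in auto)
qed

section \<open>The action satisfies the relations\<close>

lemma step_Vertex: "step (Vertex v) p = (if target E (last p) = v then word p else 0)"
  by (simp add: step_def)

text \<open>This is relation (3) for the action. If the edges can be appended to \<open>p\<close>
  without rewriting, the special summand cancels all others by the choice of \<open>red\<close>.
  Otherwise \<open>p\<close> ends in a ghost of index \<open>1\<close> and \<open>i = 1\<close>, and
  both rules apply in succession.\<close>

lemma act_edge_ghost:
  fixes p :: "('v, 'e) symbol list"
  assumes "good p" "v \<in> verts E" "out_arcs E v \<noteq> {}"
    and "1 \<le> i" "i \<le> vertex_weight E \<omega> v" "1 \<le> j" "j \<le> vertex_weight E \<omega> v"
  shows "(\<Sum>\<alpha> | \<alpha> \<in> out_arcs E v \<and> i \<le> \<omega> \<alpha> \<and> j \<le> \<omega> \<alpha>. act (Ghost \<alpha> j) (step (Edge \<alpha> i) p))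
    = (if i = j then step (Vertex v) p else (0 :: _ \<Rightarrow>\<^sub>0 'r::ring_1))"
proof -
  define S where "S = {\<alpha> \<in> out_arcs E v. i \<le> \<omega> \<alpha> \<and> j \<le> \<omega> \<alpha>}"
  define s where "s = sp v"
  define S' where "S' = S - {s}"
  have s: "s \<in> arcs E" "tail E s = v" "\<omega> s = vertex_weight E \<omega> v"
    using sp_out[of v] sp_weight[of v] assms(2,3) by (auto simp: s_def)
  have fin: "finite S" "finite S'"
    using finite_out_arcs[of v] by (simp_all add: S_def S'_def del: in_out_arcs_conv)
  \<comment> \<open>Maximality of the weight of \<open>s\<close> enters here: the special summand is
    present for all admissible \<open>i\<close> and \<open>j\<close>.\<close>
  have S: "S = insert s S'" "s \<notin> S'"
    using s assms by (auto simp: S_def S'_def)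
  have S'D: "\<alpha> \<in> arcs E" "tail E \<alpha> = v" "\<alpha> \<noteq> s" "i \<le> \<omega> \<alpha>" "j \<le> \<omega> \<alpha>" if "\<alpha> \<in> S'" for \<alpha>
    using that by (auto simp: S'_def S_def)
  let ?f = "\<lambda>\<alpha>. act (Ghost \<alpha> j) (step (Edge \<alpha> i) p) :: _ \<Rightarrow>\<^sub>0 'r"
  have "sum ?f S = (if i = j then step (Vertex v) p else 0)"
  proof (cases "target E (last p) = v")
    case False
    then have "?f \<alpha> = 0" if "\<alpha> \<in> S" for \<alpha>
      using that by (auto simp: step_def S_def)
    with False show ?thesis by (simp add: step_def)
  next
    case v: True
    show ?thesis
    proof (cases "i = 1 \<and> (\<exists>\<gamma>. last p = Ghost \<gamma> 1)")
      case False
      then have nf: "\<not> forb (last p) (Edge \<alpha> i)" for \<alpha>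
        by (cases "last p") auto
      have st: "step (Edge \<alpha> i) p = (word (p @ [Edge \<alpha> i]) :: _ \<Rightarrow>\<^sub>0 'r)" if "\<alpha> \<in> S" for \<alpha>
        using that v nf by (auto simp: step_def S_def)
      have 1: "?f \<alpha> = word (p @ [Edge \<alpha> i, Ghost \<alpha> j])" if "\<alpha> \<in> S'" for \<alpha>
        using that S'D[OF that] S(1) by (subst st) (auto simp: step_def s_def)
      have "?f s = word p * red (Edge s i) (Ghost s j)"
        using S(1) s by (subst st) (auto simp: step_def s_def)
      also have "\<dots> = (if i = j then word p else 0) - (\<Sum>\<gamma>\<in>S'. word (p @ [Edge \<gamma> i, Ghost \<gamma> j]))"
      proof -
        have "{\<gamma> \<in> out_arcs E (tail E s). \<gamma> \<noteq> s \<and> i \<le> \<omega> \<gamma> \<and> j \<le> \<omega> \<gamma>} = S'"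
          using s by (auto simp: S'_def S_def)
        then show ?thesis
          by (simp add: right_diff_distrib sum_distrib_left mult_single_list)
      qed
      finally show ?thesis
        using v fin S(2) by (simp add: S(1) 1 step_Vertex)
    next
      case True
      then obtain \<gamma> where i: "i = 1" and last: "last p = Ghost \<gamma> 1" by blast
      obtain q where p: "p = q @ [Ghost \<gamma> 1]" "q \<noteq> []" "good q" "\<gamma> \<in> arcs E" "1 \<le> \<omega> \<gamma>"
          "target E (last q) = head E \<gamma>" "\<not> forb (last q) (Ghost \<gamma> 1)"
        using good_lastD[OF assms(1) last] by auto
      have nf: "\<not> forb (last q) (Ghost \<gamma> k)" for k
        using p(7) by (cases "last q") auto
      have \<gamma>: "tail E \<gamma> = v" using v p(1) by simp
      have \<gamma>s: "\<omega> \<gamma> \<le> \<omega> s" using weight_le_sp[OF p(4)] by (simp add: s_def \<gamma>)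
      \<comment> \<open>\<open>T\<close> collects the correction terms, which reach this form from
        both rules; \<open>W\<close> and \<open>D\<close> come from the Kronecker deltas in
        relations (3) and (4), respectively.\<close>
      define T where "T k \<alpha> = (word (q @ [Ghost \<gamma> k, Edge \<alpha> k, Ghost \<alpha> j]) :: _ \<Rightarrow>\<^sub>0 'r)" for k \<alpha>
      define W where "W = (word (q @ [Ghost \<gamma> j]) :: _ \<Rightarrow>\<^sub>0 'r)"
      define D where "D \<alpha> = (if \<gamma> = \<alpha> then step (Ghost \<alpha> j) q else (0 :: _ \<Rightarrow>\<^sub>0 'r))" for \<alpha>
      have f: "?f \<alpha> = D \<alpha>
          - (\<Sum>k = 2..min (\<omega> \<gamma>) (\<omega> \<alpha>). step (Ghost \<alpha> j) (q @ [Ghost \<gamma> k, Edge \<alpha> k]))"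
        if "\<alpha> \<in> S" for \<alpha>
      proof -
        have "tail E \<alpha> = v" using that by (auto simp: S_def)
        then have "step (Edge \<alpha> i) p = (if \<gamma> = \<alpha> then word q else 0)
            - (\<Sum>k = 2..min (\<omega> \<gamma>) (\<omega> \<alpha>). (word (q @ [Ghost \<gamma> k, Edge \<alpha> k]) :: _ \<Rightarrow>\<^sub>0 'r))"
          using \<gamma> i by (simp add: step_def p(1) right_diff_distrib sum_distrib_left mult_single_list)
        then show ?thesis by (simp add: D_def act_if)
      qed
      have 1: "?f \<alpha> = D \<alpha> - (\<Sum>k = 2..min (\<omega> \<gamma>) (\<omega> \<alpha>). T k \<alpha>)" if "\<alpha> \<in> S'" for \<alpha>
      proof -
        have "step (Ghost \<alpha> j) (q @ [Ghost \<gamma> k, Edge \<alpha> k]) = T k \<alpha>" for k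
          using S'D[OF that] by (simp add: step_def T_def s_def)
        then show ?thesis using f[of \<alpha>] that S(1) by simp
      qed
      have 2: "step (Ghost s j) (q @ [Ghost \<gamma> k, Edge s k])
          = (if k = j then W else 0) - (\<Sum>\<beta> | \<beta> \<in> S' \<and> k \<le> \<omega> \<beta>. T k \<beta>)" if "2 \<le> k" for k
      proof -
        \<comment> \<open>As \<open>i = 1\<close>, the bound \<open>i \<le> \<omega> \<beta>\<close>
          in the definition of \<open>S\<close> follows from
          \<open>k \<le> \<omega> \<beta>\<close>.\<close>
        have "{\<beta> \<in> out_arcs E (tail E s). \<beta> \<noteq> s \<and> k \<le> \<omega> \<beta> \<and> j \<le> \<omega> \<beta>} = {\<beta> \<in> S'. k \<le> \<omega> \<beta>}"
          using s i that by (auto simp: S'_def S_def)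
        then have "red (Edge s k) (Ghost s j)
            = (if k = j then 1 else 0) - (\<Sum>\<beta> | \<beta> \<in> S' \<and> k \<le> \<omega> \<beta>. (word [Edge \<beta> k, Ghost \<beta> j] :: _ \<Rightarrow>\<^sub>0 'r))"
          by simp
        then have "word (q @ [Ghost \<gamma> k]) * red (Edge s k) (Ghost s j)
            = (if k = j then W else 0) - (\<Sum>\<beta> | \<beta> \<in> S' \<and> k \<le> \<omega> \<beta>. T k \<beta>)"
          by (simp add: right_diff_distrib sum_distrib_left mult_single_list T_def W_def)
        then show ?thesis
          using s by (simp add: step_def s_def butlast_append)
      qed
      \<comment> \<open>Rewriting at the special arc gives the double sum ordered by
        \<open>k\<close>; the other arcs contribute it ordered by arcs and with the opposite
        sign.\<close>
      have "(\<Sum>k = 2..\<omega> \<gamma>. \<Sum>\<beta> | \<beta> \<in> S' \<and> k \<le> \<omega> \<beta>. T k \<beta>)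
          = (\<Sum>\<beta>\<in>S'. \<Sum>k | k \<in> {2..\<omega> \<gamma>} \<and> k \<le> \<omega> \<beta>. T k \<beta>)"
        by (rule sum.swap_restrict) (use fin in auto)
      also have "\<dots> = (\<Sum>\<beta>\<in>S'. \<Sum>k = 2..min (\<omega> \<gamma>) (\<omega> \<beta>). T k \<beta>)"
        by (intro sum.cong refl) auto
      finally have 3: "?f s = D s - (\<Sum>k = 2..\<omega> \<gamma>. if k = j then W else 0)
          + (\<Sum>\<beta>\<in>S'. \<Sum>k = 2..min (\<omega> \<gamma>) (\<omega> \<beta>). T k \<beta>)"
        using f[of s] S(1) \<gamma>s by (simp add: 2 sum_subtractf)
      have "sum D S = (if \<gamma> \<in> S then step (Ghost \<gamma> j) q else 0)"
        using fin(1) by (simp add: D_def)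
      also have "\<dots> = (if j \<le> \<omega> \<gamma> then W else 0)"
        using p \<gamma> i nf by (auto simp: S_def step_def W_def)
      finally have D: "sum D S = (if j \<le> \<omega> \<gamma> then W else 0)" .
      \<comment> \<open>The first term contributes \<open>W\<close> for
        \<open>1 \<le> j \<le> \<omega> \<gamma>\<close>, the second removes it for
        \<open>2 \<le> j \<le> \<omega> \<gamma>\<close>. What remains is the case
        \<open>j = 1\<close>, where \<open>W\<close> is the path \<open>p\<close> itself.\<close>
      have "sum ?f S = sum D S - (\<Sum>k = 2..\<omega> \<gamma>. if k = j then W else 0)"
        using fin S(2) by (simp add: S(1) 1 3 sum_subtractf)
      also have "\<dots> = (if i = j then word p else 0)"
        using assms(6) p(5) i by (auto simp: D W_def p(1))
      finally show ?thesis using v by (simp add: step_Vertex)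
    qed
  qed
  then show ?thesis unfolding S_def .
qed

text \<open>This is relation (4) for the action, dual to the preceding argument with arcs and
  indices exchanged. The hard case is a path that ends in an edge of the special arc
  \<open>\<alpha>\<close>; the index \<open>1\<close> now has the part that the special arc had
  before.\<close>

lemma act_ghost_edge:
  fixes p :: "('v, 'e) symbol list"
  assumes "good p" "\<alpha> \<in> arcs E" "\<beta> \<in> arcs E"
  shows "(\<Sum>i = 1..min (\<omega> \<alpha>) (\<omega> \<beta>). act (Edge \<beta> i) (step (Ghost \<alpha> i) p))
    = (if \<alpha> = \<beta> then step (Vertex (head E \<alpha>)) p else (0 :: _ \<Rightarrow>\<^sub>0 'r::ring_1))"
proof -
  let ?f = "\<lambda>i. act (Edge \<beta> i) (step (Ghost \<alpha> i) p) :: _ \<Rightarrow>\<^sub>0 'r"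
  let ?M = "{1..min (\<omega> \<alpha>) (\<omega> \<beta>)}" and ?M' = "{2..min (\<omega> \<alpha>) (\<omega> \<beta>)}"
  have M: "?M = insert 1 ?M'" using weight_pos assms(2,3) by fastforce
  consider "target E (last p) \<noteq> head E \<alpha>" | "tail E \<alpha> \<noteq> tail E \<beta>"
    | "target E (last p) = head E \<alpha>" "tail E \<alpha> = tail E \<beta>" by blast
  then show ?thesis
  proof cases
    case 1
    then show ?thesis by (auto simp: step_def)
  next
    case 2
    \<comment> \<open>The statement is needed for combinations \<open>m\<close>, since appending the
      ghost may itself require a rewriting; all resulting paths still end at the tail of
      \<open>\<alpha>\<close>.\<close>
    have "act (Edge \<beta> i) m = 0"
      if "\<And>q. q \<in> Poly_Mapping.keys m \<Longrightarrow> target E (last q) = tail E \<alpha>" for m :: "_ \<Rightarrow>\<^sub>0 'r" and i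
      using that 2 unfolding act_def lin_def by (intro sum.neutral) (auto simp: step_def)
    then have "?f i = 0" if "i \<in> ?M" for i
      using step_closed[OF assms(1), of "Ghost \<alpha> i"] assms(2) that by (force simp: symbols_def)
    with 2 show ?thesis by auto
  next
    case eq: 3
    define v where "v = tail E \<alpha>"
    have v: "tail E \<alpha> = v" "tail E \<beta> = v" using eq by (simp_all add: v_def)
    show ?thesis
    proof (cases "\<exists>j. last p = Edge \<alpha> j \<and> sp v = \<alpha>")
      case False
      then have nf: "\<not> forb (last p) (Ghost \<alpha> i)" for i
        using v by (cases "last p") auto
      have st: "step (Ghost \<alpha> i) p = (word (p @ [Ghost \<alpha> i]) :: _ \<Rightarrow>\<^sub>0 'r)" for i
        using eq nf by (auto simp: step_def)
      have 1: "?f i = word (p @ [Ghost \<alpha> i, Edge \<beta> i])" if "i \<in> ?M'" for i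
        using that v unfolding st by (auto simp: step_def)
      have "?f 1 = word p * red (Ghost \<alpha> 1) (Edge \<beta> 1)"
        using v unfolding st by (simp add: step_def)
      also have "\<dots> = (if \<alpha> = \<beta> then word p else 0) - (\<Sum>i\<in>?M'. word (p @ [Ghost \<alpha> i, Edge \<beta> i]))"
        by (simp add: right_diff_distrib sum_distrib_left mult_single_list)
      finally show ?thesis
        unfolding M using eq 1 by (simp add: step_Vertex)
    next
      case True
      then obtain j where last: "last p = Edge \<alpha> j" and sp: "sp v = \<alpha>" by blast
      obtain q where p: "p = q @ [Edge \<alpha> j]" "q \<noteq> []" "good q" "1 \<le> j" "j \<le> \<omega> \<alpha>"
          "target E (last q) = v" "\<not> forb (last q) (Edge \<alpha> j)"
        using good_lastD[OF assms(1) last] v by auto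
      have nf: "\<not> forb (last q) (Edge \<gamma> j)" for \<gamma>
        using p(7) by (cases "last q") auto
      have \<beta>\<alpha>: "\<omega> \<beta> \<le> \<omega> \<alpha>" using weight_le_sp[OF assms(3)] by (simp add: v sp)
      define C where "C = {\<gamma> \<in> out_arcs E v. \<gamma> \<noteq> \<alpha> \<and> j \<le> \<omega> \<gamma>}"
      have fin: "finite C" using finite_out_arcs[of v] by (simp add: C_def del: in_out_arcs_conv)
      have CD: "\<gamma> \<in> arcs E" "tail E \<gamma> = v" "\<gamma> \<noteq> \<alpha>" if "\<gamma> \<in> C" for \<gamma>
        using that by (auto simp: C_def)
      define T where "T i \<gamma> = (word (q @ [Edge \<gamma> j, Ghost \<gamma> i, Edge \<beta> i]) :: _ \<Rightarrow>\<^sub>0 'r)" for i \<gamma>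
      define W where "W = (word (q @ [Edge \<beta> j]) :: _ \<Rightarrow>\<^sub>0 'r)"
      define D where "D i = (if i = j then step (Edge \<beta> i) q else (0 :: _ \<Rightarrow>\<^sub>0 'r))" for i
      have f: "?f i = D i - (\<Sum>\<gamma> | \<gamma> \<in> C \<and> i \<le> \<omega> \<gamma>. step (Edge \<beta> i) (q @ [Edge \<gamma> j, Ghost \<gamma> i]))" for i
      proof -
        have "{\<gamma> \<in> out_arcs E v. \<gamma> \<noteq> \<alpha> \<and> j \<le> \<omega> \<gamma> \<and> i \<le> \<omega> \<gamma>} = {\<gamma> \<in> C. i \<le> \<omega> \<gamma>}"
          by (auto simp: C_def)
        then have "step (Ghost \<alpha> i) p = (if i = j then word q else 0)
            - (\<Sum>\<gamma> | \<gamma> \<in> C \<and> i \<le> \<omega> \<gamma>. (word (q @ [Edge \<gamma> j, Ghost \<gamma> i]) :: _ \<Rightarrow>\<^sub>0 'r))"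
          using v sp by (auto simp: step_def p(1) right_diff_distrib sum_distrib_left mult_single_list)
        then show ?thesis by (simp add: D_def act_if)
      qed
      have 1: "?f i = D i - (\<Sum>\<gamma> | \<gamma> \<in> C \<and> i \<le> \<omega> \<gamma>. T i \<gamma>)" if "2 \<le> i" for i
        unfolding f using that v CD by (intro arg_cong2[of _ _ _ _ minus] sum.cong refl) (auto simp: step_def T_def)
      have 2: "step (Edge \<beta> 1) (q @ [Edge \<gamma> j, Ghost \<gamma> 1])
          = (if \<gamma> = \<beta> then W else 0) - (\<Sum>k = 2..min (\<omega> \<gamma>) (\<omega> \<beta>). T k \<gamma>)" if "\<gamma> \<in> C" for \<gamma>
        using v CD[OF that]
        by (simp add: step_def T_def W_def butlast_append right_diff_distrib sum_distrib_left mult_single_list)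
      \<comment> \<open>The rewriting at index \<open>1\<close> yields this sum ordered by arcs, the
        indices from \<open>2\<close> on yield it ordered by index.\<close>
      have "(\<Sum>\<gamma>\<in>C. \<Sum>k = 2..min (\<omega> \<gamma>) (\<omega> \<beta>). T k \<gamma>) = (\<Sum>\<gamma>\<in>C. \<Sum>k | k \<in> {2..\<omega> \<beta>} \<and> k \<le> \<omega> \<gamma>. T k \<gamma>)"
        by (intro sum.cong refl) auto
      also have "\<dots> = (\<Sum>k = 2..\<omega> \<beta>. \<Sum>\<gamma> | \<gamma> \<in> C \<and> k \<le> \<omega> \<gamma>. T k \<gamma>)"
        by (rule sum.swap_restrict[symmetric]) (use fin in auto)
      moreover have "{\<gamma> \<in> C. 1 \<le> \<omega> \<gamma>} = C" using weight_pos CD by auto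
      ultimately have 3: "?f 1 = D 1 - (\<Sum>\<gamma>\<in>C. if \<gamma> = \<beta> then W else 0)
          + (\<Sum>k = 2..\<omega> \<beta>. \<Sum>\<gamma> | \<gamma> \<in> C \<and> k \<le> \<omega> \<gamma>. T k \<gamma>)"
        unfolding f by (simp add: 2 sum_subtractf del: One_nat_def)
      have "sum D ?M = (if j \<in> ?M then step (Edge \<beta> j) q else 0)"
        by (simp add: D_def)
      also have "\<dots> = (if j \<le> \<omega> \<beta> then W else 0)"
        using p v nf by (auto simp: step_def W_def)
      finally have D: "sum D ?M = (if j \<le> \<omega> \<beta> then W else 0)" .
      \<comment> \<open>If \<open>\<beta> \<noteq> \<alpha>\<close>, then \<open>\<beta>\<close>
        lies in \<open>C\<close> exactly when \<open>j \<le> \<omega> \<beta>\<close>, and the two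
        terms cancel. If \<open>\<beta> = \<alpha>\<close>, it is not in \<open>C\<close>, and
        \<open>W\<close>, which is then the path \<open>p\<close>, survives.\<close>
      have "sum ?f ?M = sum D ?M - (\<Sum>\<gamma>\<in>C. if \<gamma> = \<beta> then W else 0)"
        unfolding M using \<beta>\<alpha> by (simp add: 1 3 sum_subtractf min_absorb2 del: One_nat_def)
      also have "\<dots> = (if \<alpha> = \<beta> then word p else 0)"
        using fin p assms(3) v unfolding D by (auto simp: W_def C_def)
      finally show ?thesis using eq by (simp add: step_Vertex)
    qed
  qed
qed

text \<open>The predicate \<open>P\<close> carries information about the initial vertex, which an
  action at the right end never changes.\<close>

lemma act_closed:
  assumes "Poly_Mapping.keys m \<subseteq> {p. good p \<and> P (hd p)}" "y \<in> symbols E \<omega>"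
  shows "Poly_Mapping.keys (act y m) \<subseteq> {p. good p \<and> P (hd p) \<and> target E (last p) = target E y}"
proof
  fix q assume "q \<in> Poly_Mapping.keys (act y m)"
  then obtain p where "p \<in> Poly_Mapping.keys m" "q \<in> Poly_Mapping.keys (step y p :: _ \<Rightarrow>\<^sub>0 'a)"
    unfolding act_def by (rule UN_E[OF subsetD[OF keys_lin]])
  then show "q \<in> {p. good p \<and> P (hd p) \<and> target E (last p) = target E y}"
    using step_closed[of p y q] assms by auto
qed

lemma actw_closed:
  assumes "Poly_Mapping.keys m \<subseteq> {p. good p \<and> P (hd p)}" "w \<in> lists (symbols E \<omega>)"
  shows "Poly_Mapping.keys (actw w m) \<subseteq> {p. good p \<and> P (hd p)}"
  using assms(2,1)
proof (induction w arbitrary: m rule: lists.induct)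
  case (Cons y w)
  have "Poly_Mapping.keys (act y m) \<subseteq> {p. good p \<and> P (hd p)}"
    using act_closed[OF Cons.prems Cons.hyps(1)] by (rule order.trans) auto
  then show ?case unfolding actw_Cons by (rule Cons.IH)
qed simp

lemma Act_closed:
  assumes "Poly_Mapping.keys m \<subseteq> {p. good p \<and> P (hd p)}" "f \<in> free_carrier"
  shows "Poly_Mapping.keys (Act m f) \<subseteq> {p. good p \<and> P (hd p)}"
proof -
  have "Poly_Mapping.keys (actw w m) \<subseteq> {p. good p \<and> P (hd p)}" if "w \<in> Poly_Mapping.keys f" for w
    using assms(2) that by (intro actw_closed[OF assms(1)]) (auto simp: carrier_free_rng)
  then have "(\<Union>w\<in>Poly_Mapping.keys f. Poly_Mapping.keys (actw w m)) \<subseteq> {p. good p \<and> P (hd p)}"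
    by (rule UN_least)
  then show ?thesis unfolding Act_def by (rule order.trans[OF keys_lin])
qed

lemma act_Vertex_id:
  assumes "Poly_Mapping.keys m \<subseteq> {p. target E (last p) = v}"
  shows "act (Vertex v) m = m"
proof -
  have "act (Vertex v) m = (\<Sum>p\<in>Poly_Mapping.keys m. word p * scalar (Poly_Mapping.lookup m p))"
    unfolding act_def lin_def using assms by (intro sum.cong refl) (auto simp: step_Vertex)
  then show ?thesis by (simp flip: single_conv_scalar poly_mapping_sum_singles)
qed

lemma Act_relation:
  assumes "s \<in> wlpa_relations E \<omega>" "good p"
  shows "Act (word p) s = (0 :: _ \<Rightarrow>\<^sub>0 'r::ring_1)"
  using assms(1)
proof (cases rule: wlpa_relations_cases)
  case (1 v w)
  then show ?thesis by (auto simp: Act_mult step_Vertex)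
next
  case (2 x)
  then show ?thesis by (auto simp: Act_mult step_Vertex step_def)
next
  case (3 x)
  then have "x \<in> symbols E \<omega>" by (auto simp: symbols_def)
  then have "Poly_Mapping.keys (step x p :: _ \<Rightarrow>\<^sub>0 'r) \<subseteq> {q. target E (last q) = target E x}"
    using step_closed[OF assms(2), of x] by auto
  then show ?thesis using 3 by (simp add: Act_mult act_Vertex_id)
next
  case (4 v i j)
  then show ?thesis
    using act_edge_ghost[OF assms(2), of v i j, where 'r='r] by (simp add: Act_mult)
next
  case (5 \<alpha> \<beta>)
  then show ?thesis
    using act_ghost_edge[OF assms(2), of \<alpha> \<beta>, where 'r='r] by (simp add: Act_mult)
qed

text \<open>Coefficients of \<open>m\<close> are pulled out past \<open>s\<close>, which is possible
  because relations commute with coefficients.\<close>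

lemma Act_relation_eq_0:
  fixes m s :: "('v, 'e) symbol list \<Rightarrow>\<^sub>0 'r::ring_1"
  assumes "s \<in> wlpa_relations E \<omega>" "Poly_Mapping.keys m \<subseteq> Collect good"
  shows "Act m s = 0"
proof (induction rule: single_induct[where f = m])
  case (single p r)
  have "Act (Poly_Mapping.single p r) s = Act (word p) (scalar r * s)"
    by (simp add: single_conv_scalar[of p r] Act_scalar_left)
  also have "\<dots> = Act (word p) s * scalar r"
    using central_relations[OF assms(1)] by (simp add: central_def)
  finally show ?case
    using single Act_relation[OF assms(1), of p] assms(2) by auto
qed (simp_all add: Act_linear_left)

text \<open>The annihilator \<open>K\<close> of the module of reduced paths is an ideal containing
  the relations. It has to annihilate every \<open>m\<close> at once: multiplying \<open>f\<close>
  on the left by \<open>g\<close> or by a coefficient amounts to changing \<open>m\<close>.\<close>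

lemma wlpa_ideal_Act:
  fixes m f :: "('v, 'e) symbol list \<Rightarrow>\<^sub>0 'r::ring_1"
  assumes "f \<in> wlpa_ideal" "Poly_Mapping.keys m \<subseteq> Collect good"
  shows "Act m f = 0"
proof -
  define K :: "(('v, 'e) symbol list \<Rightarrow>\<^sub>0 'r) set" where
    "K = {f \<in> free_carrier. \<forall>m. Poly_Mapping.keys m \<subseteq> Collect good \<longrightarrow> Act m f = 0}"
  have "coeff_ideal K (symbols E \<omega>)"
    unfolding coeff_ideal_iff
  proof (intro conjI ballI allI)
    fix f g assume "f \<in> K" "g \<in> (free_carrier :: (_ \<Rightarrow>\<^sub>0 'r) set)"
    moreover from this have "Poly_Mapping.keys (Act m g) \<subseteq> Collect good"
      if "Poly_Mapping.keys m \<subseteq> Collect good" for m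
      using Act_closed[of m "\<lambda>_. True" g] that by simp
    ultimately show "f * g \<in> K" "g * f \<in> K"
      by (auto simp: K_def Act_mult Act_linear_left)
  next
    fix r f assume "f \<in> K"
    then show "scalar r * f \<in> K"
      using keys_scalar[of _ r] unfolding K_def by (simp add: Act_scalar_left) blast
  qed (auto simp: K_def)
  moreover have "wlpa_relations E \<omega> \<subseteq> K"
    using wlpa_relations_subset Act_relation_eq_0 by (auto simp: K_def)
  ultimately have "wlpa_ideal \<subseteq> K" by (rule gen_coeff_ideal_subset)
  then show ?thesis using assms by (auto simp: K_def)
qed

section \<open>The action as right multiplication modulo the ideal\<close>

lemma good_symbols_last: "good p \<Longrightarrow> last p \<in> symbols E \<omega>"
  using good_symbols[of p] last_in_set[of p] by auto

lemma good_carrier: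
  assumes "Poly_Mapping.keys m \<subseteq> Collect good"
  shows "m \<in> free_carrier"
  using assms good_symbols unfolding carrier_free_rng by blast

text \<open>Each clause of \<open>step\<close> is a consequence of the relations, so rewriting does
  not change the class of an element. The delicate clause is the forbidden one, where
  \<open>red\<close> has a \<open>1\<close> in place of a vertex.\<close>

lemma word_letter_step:
  assumes "good p" "y \<in> symbols E \<omega>"
  shows "word p * letter y - step y p \<in> (wlpa_ideal :: (_ \<Rightarrow>\<^sub>0 'r::ring_1) set)"
proof -
  let ?I = "wlpa_ideal :: (('v, 'e) symbol list \<Rightarrow>\<^sub>0 'r) set"
  let ?V = "\<lambda>u. letter (Vertex u) :: ('v, 'e) symbol list \<Rightarrow>\<^sub>0 'r"
  obtain q x where p: "p = q @ [x]"
    using good_not_Nil[OF assms(1)] by (cases p rule: rev_cases) auto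
  have x: "x \<in> symbols E \<omega>" and q: "q \<in> lists (symbols E \<omega>)"
    using good_symbols[OF assms(1)] by (auto simp: p)
  have w: "word p = word q * (letter x :: _ \<Rightarrow>\<^sub>0 'r)"
    by (simp add: p letter_def mult_single_list)
  consider (mismatch) "target E x \<noteq> source E y" | (vertex) "y = Vertex (target E x)"
    | (free) "target E x = source E y" "y \<notin> range Vertex" "\<not> forb x y"
    | (forb) "target E x = source E y" "y \<notin> range Vertex" "forb x y"
    by (cases y) auto
  then show ?thesis
  proof cases
    case mismatch
    then show ?thesis
      using wlpa_ideal_word(1)[OF q mult_mismatch[OF x assms(2)]] unfolding w
      by (simp add: step_def p mult.assoc)
  next
    case vertex
    then show ?thesis
      using wlpa_ideal_word(1)[OF q target_mult[OF x]]
      by (simp add: step_Vertex w right_diff_distrib mult.assoc) (simp add: p)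
  next
    case free
    then show ?thesis
      by (simp add: step_def p letter_def mult_single_list wlpa_ideal_closed(1))
  next
    case forb
    then have "last p \<notin> range Vertex" by (cases x; cases y) (auto simp: p)
    with assms(1) have q': "q \<noteq> []" "good q" "target E (last q) = source E x"
      by (auto simp: p elim!: good_last_cases)
    \<comment> \<open>The word \<open>q\<close> ends in the vertex \<open>source E x\<close> and
      absorbs it modulo the ideal, so this vertex may be replaced by \<open>1\<close>.\<close>
    have "word q * ?V (source E x) - word q \<in> ?I"
    proof -
      have "word (butlast q) * (letter (last q) * ?V (target E (last q)) - letter (last q)) \<in> ?I"
        using q good_symbols_last[OF q'(2)]
        by (intro wlpa_ideal_word(1) target_mult) (auto dest: in_set_butlastD)
      moreover have "word (butlast q) * letter (last q) = (word q :: _ \<Rightarrow>\<^sub>0 'r)"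
        using q'(1) by (simp add: letter_def mult_single_list)
      ultimately show ?thesis
        by (simp add: right_diff_distrib q'(3) flip: mult.assoc)
    qed
    note local = this
    consider (edge) \<alpha> i j where "x = Edge \<alpha> i" "y = Ghost \<alpha> j" "sp (tail E \<alpha>) = \<alpha>"
      | (ghost) \<alpha> \<beta> where "x = Ghost \<alpha> 1" "y = Edge \<beta> 1"
      using forb by (cases x; cases y) auto
    \<comment> \<open>The truth value \<open>b\<close> is the condition of the Kronecker delta in
      the relation; it tells whether the vertex, and with it the \<open>1\<close> in
      \<open>red\<close>, occurs at all.\<close>
    then obtain b :: bool where rel: "letter x * letter y - red x y - (if b then ?V (source E x) - 1 else 0) \<in> ?I"
    proof cases
      case (edge \<alpha> i j)
      let ?v = "tail E \<alpha>"
      let ?S = "{\<gamma> \<in> out_arcs E ?v. i \<le> \<omega> \<gamma> \<and> j \<le> \<omega> \<gamma>}"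
      let ?f = "\<lambda>\<gamma>. letter (Edge \<gamma> i) * letter (Ghost \<gamma> j) :: _ \<Rightarrow>\<^sub>0 'r"
      have \<alpha>: "\<alpha> \<in> arcs E" "1 \<le> i" "i \<le> \<omega> \<alpha>" "1 \<le> j" "j \<le> \<omega> \<alpha>"
        using x assms(2) edge by (auto elim: symbols_cases)
      then have "\<omega> \<alpha> = vertex_weight E \<omega> ?v"
        using sp_weight[of ?v] edge(3) by force
      then have "sum ?f ?S - (if i = j then ?V ?v else 0) \<in> ?I"
        using \<alpha> by (intro wlpa_ideal_closed(8) wlpa_relations_intros(4)) auto
      moreover have "sum ?f ?S = letter x * letter y + sum ?f (?S - {\<alpha>})"
        unfolding edge(1,2) using \<alpha> finite_out_arcs[of ?v]
        by (intro sum.remove) (simp_all del: in_out_arcs_conv, simp)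
      moreover have "red x y = (if i = j then 1 else 0) - sum ?f (?S - {\<alpha>})"
      proof -
        have "?S - {\<alpha>} = {\<gamma> \<in> out_arcs E ?v. \<gamma> \<noteq> \<alpha> \<and> i \<le> \<omega> \<gamma> \<and> j \<le> \<omega> \<gamma>}" by blast
        then show ?thesis unfolding edge(1,2) red.simps by (simp add: letter_def mult_single_list)
      qed
      moreover have "source E x = ?v" using edge(1) by simp
      ultimately show ?thesis by (intro that[of "i = j"]) (simp split: if_splits)
    next
      case (ghost \<alpha> \<beta>)
      let ?f = "\<lambda>i. letter (Ghost \<alpha> i) * letter (Edge \<beta> i) :: _ \<Rightarrow>\<^sub>0 'r"
      have \<alpha>: "\<alpha> \<in> arcs E" "\<beta> \<in> arcs E"
        using x assms(2) ghost by (auto elim: symbols_cases)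
      then have "(\<Sum>i = 1..min (\<omega> \<alpha>) (\<omega> \<beta>). ?f i) - (if \<alpha> = \<beta> then ?V (head E \<alpha>) else 0) \<in> ?I"
        by (intro wlpa_ideal_closed(8) wlpa_relations_intros(5))
      moreover have "{1..min (\<omega> \<alpha>) (\<omega> \<beta>)} = insert 1 {2..min (\<omega> \<alpha>) (\<omega> \<beta>)}"
        using weight_pos \<alpha> by fastforce
      then have "(\<Sum>i = 1..min (\<omega> \<alpha>) (\<omega> \<beta>). ?f i)
          = letter x * letter y + (\<Sum>i = 2..min (\<omega> \<alpha>) (\<omega> \<beta>). ?f i)"
        unfolding ghost by simp
      moreover have "red x y = (if \<alpha> = \<beta> then 1 else 0) - (\<Sum>i = 2..min (\<omega> \<alpha>) (\<omega> \<beta>). ?f i)"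
        unfolding ghost red.simps by (simp add: letter_def mult_single_list)
      moreover have "source E x = head E \<alpha>" using ghost(1) by simp
      ultimately show ?thesis by (intro that[of "\<alpha> = \<beta>"]) (simp split: if_splits)
    qed
    have "word q * (letter x * letter y - red x y - (if b then ?V (source E x) - 1 else 0))
        + (if b then word q * ?V (source E x) - word q else 0) \<in> ?I"
      using wlpa_ideal_word(1)[OF q rel] local by (intro wlpa_ideal_closed(2)) (simp_all add: wlpa_ideal_closed(1))
    then show ?thesis
      using forb by (simp add: step_def w mult.assoc) (simp add: p right_diff_distrib split: if_splits)
  qed
qed

lemma mult_letter_act:
  fixes m :: "('v, 'e) symbol list \<Rightarrow>\<^sub>0 'r::ring_1"
  assumes "Poly_Mapping.keys m \<subseteq> Collect good" "y \<in> symbols E \<omega>"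
  shows "m * letter y - act y m \<in> wlpa_ideal"
proof (induction rule: single_induct[where f = m])
  case (single p r)
  have "(word p * letter y - step y p) * scalar r \<in> wlpa_ideal"
    using single assms by (intro wlpa_ideal_closed(6) word_letter_step) auto
  moreover have "scalar r * letter y = letter y * scalar r"
    using central_intros(2)[of y] unfolding central_def by blast
  ultimately show ?case
    by (simp add: single_conv_scalar[of p r] left_diff_distrib mult.assoc)
next
  case (add f g)
  then show ?case using wlpa_ideal_closed(2) by (fastforce simp: distrib_right add_diff_add)
qed (simp add: wlpa_ideal_closed(1))

lemma mult_word_actw:
  fixes m :: "('v, 'e) symbol list \<Rightarrow>\<^sub>0 'r::ring_1"
  assumes "w \<in> lists (symbols E \<omega>)" "Poly_Mapping.keys m \<subseteq> Collect good"
  shows "m * word w - actw w m \<in> wlpa_ideal"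
  using assms
proof (induction w arbitrary: m rule: lists.induct)
  case Nil
  then show ?case
    unfolding actw_Nil by (simp add: wlpa_ideal_closed(1) flip: zero_list_def)
next
  case (Cons y w)
  have "m * letter y * word w - act y m * word w \<in> wlpa_ideal"
    using wlpa_ideal_word(2)[OF Cons.hyps(2) mult_letter_act[OF Cons.prems Cons.hyps(1)]]
    by (simp add: left_diff_distrib)
  moreover have "act y m * word w - actw w (act y m) \<in> wlpa_ideal"
    using act_closed[of m "\<lambda>_. True" y] Cons.prems Cons.hyps by (intro Cons.IH) auto
  ultimately have "m * letter y * word w - actw w (act y m) \<in> wlpa_ideal"
    by (rule wlpa_ideal_trans)
  then show ?case by (simp add: letter_def mult_single_list mult.assoc)
qed

text \<open>Taken with a vertex for \<open>m\<close>, this provides a representative of the product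
  that is supported on reduced paths.\<close>

lemma mult_Act:
  fixes m f :: "('v, 'e) symbol list \<Rightarrow>\<^sub>0 'r::ring_1"
  assumes "f \<in> free_carrier" "Poly_Mapping.keys m \<subseteq> Collect good"
  shows "m * f - Act m f \<in> wlpa_ideal"
proof (induction rule: single_induct[where f = f])
  case (single w r)
  have "(m * word w - actw w m) * scalar r \<in> wlpa_ideal"
    using single assms
    by (intro wlpa_ideal_closed(6) mult_word_actw) (auto simp: carrier_free_rng)
  then show ?case
    by (simp add: single_conv_scalar[of w r] left_diff_distrib mult.assoc)
next
  case (add f g)
  then show ?case using wlpa_ideal_closed(2) by (fastforce simp: distrib_left add_diff_add)
qed (simp add: wlpa_ideal_closed(1))

text \<open>No rewriting takes place: the last letter of \<open>r\<close> begins no forbidden pair,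
  and the reduced path \<open>q\<close> contains none. The initial vertex of \<open>q\<close> acts
  as the identity and disappears, whence \<open>tl q\<close>.\<close>

lemma actw_good:
  assumes "good q" "hd q = Vertex (target E (last r))" "r \<noteq> []" "\<And>y. \<not> forb (last r) y"
  shows "actw q (word r) = (word (r @ tl q) :: _ \<Rightarrow>\<^sub>0 'r::ring_1)"
  using assms(1,2)
proof (induction q rule: good.induct)
  case (good_vertex u)
  then show ?case by (simp add: step_Vertex)
next
  case (good_snoc q y)
  have q: "q \<noteq> []" using good_not_Nil good_snoc.hyps(1) by blast
  have y: "y \<notin> range Vertex" using good_snoc.hyps(2) by auto
  have "target E (last (r @ tl q)) = source E y \<and> \<not> forb (last (r @ tl q)) y"
  proof (cases "tl q = []")
    case True
    then have "last q = hd q" using q by (cases q) auto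
    then show ?thesis using True good_snoc.hyps(3) good_snoc.prems q assms(4) by simp
  next
    case False
    then show ?thesis using good_snoc.hyps(3,4) by (simp add: last_tl)
  qed
  then have "act y (word (r @ tl q)) = (word (r @ tl q @ [y]) :: _ \<Rightarrow>\<^sub>0 'r)"
    using y by (simp add: step_def)
  then show ?case
    using good_snoc q by simp
qed

lemma keys_longest:
  assumes "f \<noteq> (0 :: 'x list \<Rightarrow>\<^sub>0 'r::zero)"
  obtains p where "p \<in> Poly_Mapping.keys f" "\<And>q. q \<in> Poly_Mapping.keys f \<Longrightarrow> length q \<le> length p"
proof -
  have "Max (length ` Poly_Mapping.keys f) \<in> length ` Poly_Mapping.keys f"
    using assms by (intro Max_in) simp_all
  then obtain p where "p \<in> Poly_Mapping.keys f" "length p = Max (length ` Poly_Mapping.keys f)"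
    by fastforce
  then show thesis using that by simp
qed

text \<open>
  If the arc of \<open>x\<close> is not the special arc at its tail and the index of \<open>x\<close> is not \<open>1\<close>, then \<open>x\<close>
  takes part in no forbidden pair, so that \<open>p x q\<close> is reduced whenever \<open>p\<close> and \<open>q\<close> are. The
  coefficient of \<open>p x q\<close> for the longest \<open>p\<close> and \<open>q\<close> is then a product of nonzero coefficients.
\<close>

lemma mult_letter_not_in_ideal:
  fixes f g :: "('v, 'e) symbol list \<Rightarrow>\<^sub>0 'r::ring_1_no_zero_divisors"
  assumes x: "x \<in> symbols E \<omega>" "x \<notin> range Vertex" "\<And>y. \<not> forb x y" "\<And>y. \<not> forb y x"
    and f: "f \<in> free_carrier" "f * letter (Vertex (source E x)) \<notin> wlpa_ideal"
    and g: "g \<in> free_carrier" "letter (Vertex (target E x)) * g \<notin> wlpa_ideal"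
  shows "f * letter x * g \<notin> wlpa_ideal"
proof
  assume fxg: "f * letter x * g \<in> wlpa_ideal"
  let ?I = "wlpa_ideal :: (('v, 'e) symbol list \<Rightarrow>\<^sub>0 'r) set"
  let ?V = "\<lambda>u. letter (Vertex u) :: ('v, 'e) symbol list \<Rightarrow>\<^sub>0 'r"
  let ?x = "letter x :: ('v, 'e) symbol list \<Rightarrow>\<^sub>0 'r"
  define v where "v = source E x"
  define w where "w = target E x"
  have vw: "v \<in> verts E" "w \<in> verts E"
    using source_target_verts[OF x(1)] by (auto simp: v_def w_def)
  have c: "?x \<in> free_carrier" "?V v \<in> free_carrier" "?V w \<in> free_carrier" "f * ?V v \<in> free_carrier"
    using x(1) vw f(1) by simp_all
  \<comment> \<open>A vertex on the left supplies the path of length zero from which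
    \<open>Act\<close> builds the representative \<open>A\<close>; all paths in \<open>A\<close>
    then share their first letter.\<close>
  obtain u where u: "u \<in> verts E" "?V u * (f * ?V v) \<notin> ?I"
    using ex_vertex_mult(1)[OF c(4)] f(2) by (auto simp: v_def)
  have cu: "?V u \<in> free_carrier" using u(1) by simp
  define A where "A = Act (?V u) (f * ?V v)"
  define B where "B = Act (?V w) g"
  have good_V: "Poly_Mapping.keys (?V u) \<subseteq> {p. good p \<and> hd p = Vertex u}" if "u \<in> verts E" for u
    using that by (simp add: letter_def good_vertex)
  have keysA: "Poly_Mapping.keys A \<subseteq> {p. good p \<and> hd p = Vertex u \<and> target E (last p) = v}"
  proof -
    have "Poly_Mapping.keys (Act (?V u) f) \<subseteq> {p. good p \<and> hd p = Vertex u}"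
      using Act_closed[of "?V u" "\<lambda>y. y = Vertex u", OF good_V[OF u(1)] f(1)] .
    then have "Poly_Mapping.keys (act (Vertex v) (Act (?V u) f))
        \<subseteq> {p. good p \<and> hd p = Vertex u \<and> target E (last p) = target E (Vertex v)}"
      using vw by (intro act_closed[where P = "\<lambda>y. y = Vertex u"]) simp_all
    then show ?thesis by (simp add: A_def Act_mult)
  qed
  have keysB: "Poly_Mapping.keys B \<subseteq> {q. good q \<and> hd q = Vertex w}"
    unfolding B_def by (rule Act_closed[of "?V w" "\<lambda>y. y = Vertex w", OF good_V[OF vw(2)] g(1)])
  have A: "?V u * (f * ?V v) - A \<in> ?I"
    unfolding A_def using good_V[OF u(1)] c(4) by (intro mult_Act) auto
  have B: "?V w * g - B \<in> ?I"
    unfolding B_def using good_V[OF vw(2)] g(1) by (intro mult_Act) auto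
  have "A \<noteq> 0" using A u(2) by auto
  moreover have "B \<noteq> 0" using B g(2) by (auto simp: w_def)
  ultimately obtain p q where
    p: "p \<in> Poly_Mapping.keys A" "\<And>p'. p' \<in> Poly_Mapping.keys A \<Longrightarrow> length p' \<le> length p" and
    q: "q \<in> Poly_Mapping.keys B" "\<And>q'. q' \<in> Poly_Mapping.keys B \<Longrightarrow> length q' \<le> length q"
    by (metis keys_longest)
  have AxB: "A * ?x * B \<in> ?I"
  proof -
    have cA: "A \<in> free_carrier" using keysA by (intro good_carrier) auto
    have "?V u * f * (?V v * ?x - ?x) * (?V w * g) \<in> ?I"
      using source_mult[OF x(1)] cu c f(1) g(1)
      by (intro wlpa_ideal_closed(3,4)) (simp_all add: v_def)
    moreover have "?V u * f * (?x * ?V w - ?x) * g \<in> ?I"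
      using target_mult[OF x(1)] cu f(1) g(1)
      by (intro wlpa_ideal_closed(3,4)) (simp_all add: w_def)
    moreover have "?V u * (f * ?x * g) \<in> ?I"
      by (rule wlpa_ideal_closed(4)[OF fxg cu])
    moreover have "(?V u * (f * ?V v) - A) * (?x * (?V w * g)) \<in> ?I"
      using c g(1) by (intro wlpa_ideal_closed(3)[OF A]) simp
    moreover have "A * ?x * (?V w * g - B) \<in> ?I"
      using c cA by (intro wlpa_ideal_closed(4)[OF B]) simp
    \<comment> \<open>The five members telescope to \<open>A * letter x * B\<close>: the vertices
      around \<open>x\<close> are inserted, and then the factors are replaced by their reduced
      representatives.\<close>
    ultimately have "?V u * f * (?V v * ?x - ?x) * (?V w * g) + ?V u * f * (?x * ?V w - ?x) * g
        + ?V u * (f * ?x * g) - (?V u * (f * ?V v) - A) * (?x * (?V w * g))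
        - A * ?x * (?V w * g - B) \<in> ?I"
      by (intro wlpa_ideal_closed(2) wlpa_ideal_diff)
    then show ?thesis by (simp add: algebra_simps)
  qed
  \<comment> \<open>Acting on the path of length zero at \<open>u\<close> reads the concatenation
    back without rewriting; only the initial vertex of \<open>q'\<close> is dropped.\<close>
  have Act_single: "Act (?V u) (Poly_Mapping.single p' a * ?x * Poly_Mapping.single q' b)
      = Poly_Mapping.single (p' @ x # tl q') (a * b)"
    if "p' \<in> Poly_Mapping.keys A" "q' \<in> Poly_Mapping.keys B" for p' q' a b
  proof -
    have p': "good p'" "hd p' = Vertex u" "target E (last p') = v" using that keysA by auto
    have q': "good q'" "hd q' = Vertex w" using that keysB by auto
    have "actw p' (?V u) = word p'"
      using actw_good[OF p'(1), of "[Vertex u]", where 'r='r] p'(2) good_not_Nil[OF p'(1)]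
      by (cases p') (simp_all add: letter_def)
    moreover have "act x (word p') = (word (p' @ [x]) :: _ \<Rightarrow>\<^sub>0 'r)"
      using x p'(3) by (simp add: step_def v_def)
    moreover have "actw q' (word (p' @ [x])) = (word (p' @ x # tl q') :: _ \<Rightarrow>\<^sub>0 'r)"
      using actw_good[OF q'(1), of "p' @ [x]", where 'r='r] q'(2) x by (simp add: w_def)
    ultimately have "actw (p' @ x # q') (?V u) = word (p' @ x # tl q')" by simp
    moreover have "Poly_Mapping.single p' a * ?x * Poly_Mapping.single q' b
        = Poly_Mapping.single (p' @ x # q') (a * b)"
      by (simp add: letter_def mult_single_list)
    ultimately show ?thesis by (simp add: scalar_def mult_single_list)
  qed
  let ?a = "Poly_Mapping.lookup A" and ?b = "Poly_Mapping.lookup B"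
  have "A * ?x * B = (\<Sum>p'\<in>Poly_Mapping.keys A. \<Sum>q'\<in>Poly_Mapping.keys B.
      Poly_Mapping.single p' (?a p') * ?x * Poly_Mapping.single q' (?b q'))"
    by (subst poly_mapping_sum_singles[of A], subst poly_mapping_sum_singles[of B])
      (simp add: sum_distrib_left sum_distrib_right, rule sum.swap)
  then have "Act (?V u) (A * ?x * B) = (\<Sum>p'\<in>Poly_Mapping.keys A. \<Sum>q'\<in>Poly_Mapping.keys B.
      Poly_Mapping.single (p' @ x # tl q') (?a p' * ?b q'))"
    by (simp add: Act_single)
  also have "Poly_Mapping.lookup \<dots> (p @ x # tl q)
      = (\<Sum>p'\<in>Poly_Mapping.keys A. \<Sum>q'\<in>Poly_Mapping.keys B. if p' = p \<and> q' = q then ?a p' * ?b q' else 0)"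
    unfolding lookup_sum
  proof (intro sum.cong refl)
    fix p' q' assume pq: "p' \<in> Poly_Mapping.keys A" "q' \<in> Poly_Mapping.keys B"
    \<comment> \<open>The letter \<open>x\<close> may also occur inside the paths, so equal words
      could be cut at different places. Neither part can exceed its maximal length while the total
      length is attained, which fixes the cut.\<close>
    have "p' = p \<and> q' = q" if eq: "p' @ x # tl q' = p @ x # tl q"
    proof -
      have hd: "good q" "good q'" "hd q = Vertex w" "hd q' = Vertex w" using keysB pq q(1) by auto
      have "length p' = length p"
        using arg_cong[OF eq, of length] p(2)[OF pq(1)] q(2)[OF pq(2)]
          good_not_Nil[OF hd(1)] good_not_Nil[OF hd(2)] by (cases q; cases q') auto
      then show ?thesis
        using eq hd good_not_Nil[OF hd(1)] good_not_Nil[OF hd(2)] by (cases q; cases q') auto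
    qed
    then show "Poly_Mapping.lookup (Poly_Mapping.single (p' @ x # tl q') (?a p' * ?b q')) (p @ x # tl q)
        = (if p' = p \<and> q' = q then ?a p' * ?b q' else 0)"
      by (auto simp: lookup_single when_def)
  qed
  also have "\<dots> = (\<Sum>p'\<in>Poly_Mapping.keys A. if p' = p then ?a p * ?b q else 0)"
    using q(1) by (intro sum.cong refl) auto
  also have "\<dots> = ?a p * ?b q" using p(1) by simp
  also have "\<dots> \<noteq> 0" using p(1) q(1) by (simp add: in_keys_iff)
  finally have "Act (?V u) (A * ?x * B) \<noteq> 0" by auto
  moreover have "Act (?V u) (A * ?x * B) = 0"
    using good_V[OF u(1)] by (intro wlpa_ideal_Act[OF AxB]) auto
  ultimately show False by simp
qed

text \<open>The vertex acts as the identity on the path of length zero at it.\<close>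

lemma vertex_not_in_ideal:
  assumes "v \<in> verts E"
  shows "letter (Vertex v) \<notin> (wlpa_ideal :: (_ \<Rightarrow>\<^sub>0 'r::ring_1) set)"
proof
  assume "letter (Vertex v) \<in> (wlpa_ideal :: (('v, 'e) symbol list \<Rightarrow>\<^sub>0 'r) set)"
  then have "Act (word [Vertex v]) (letter (Vertex v)) = (0 :: ('v, 'e) symbol list \<Rightarrow>\<^sub>0 'r)"
    using assms by (intro wlpa_ideal_Act) (simp_all add: good_vertex)
  moreover have "Act (word [Vertex v]) (letter (Vertex v)) = (word [Vertex v] :: ('v, 'e) symbol list \<Rightarrow>\<^sub>0 'r)"
    by (simp add: step_Vertex)
  ultimately have "Poly_Mapping.keys (word [Vertex v] :: ('v, 'e) symbol list \<Rightarrow>\<^sub>0 'r) = {}" by simp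
  then show False by simp
qed

end

section \<open>Primeness\<close>

text \<open>An elementwise criterion that does without a unit: for representatives \<open>a\<close>,
  \<open>b\<close> of nonzero members of two ideals, the middle factor \<open>c\<close> is absorbed
  by the first ideal, so the class of the triple product lies in the product of the ideals. The
  element \<open>x\<close> ensures that the quotient is not zero.\<close>

lemma (in rng_ideal) prime_rng_quotientI:
  assumes "x \<in> carrier R" "x \<notin> I"
    and prime: "\<And>a b. a \<in> carrier R \<Longrightarrow> b \<in> carrier R \<Longrightarrow> a \<notin> I \<Longrightarrow> b \<notin> I
      \<Longrightarrow> \<exists>c\<in>carrier R. a \<otimes> c \<otimes> b \<notin> I"
  shows "prime_rng (R Quot I)"
proof -
  let ?Q = "R Quot I"
  have carrier: "carrier ?Q = {I +> a | a. a \<in> carrier R}" and zero: "\<zero>\<^bsub>?Q\<^esub> = I"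
    by (auto simp: FactRing_simps)
  have coset: "I +> a = I \<longleftrightarrow> a \<in> I" if "a \<in> carrier R" for a
    using that a_coset_join1 a_coset_join2 a_subgroup by blast
  have mult: "(I +> a) \<otimes>\<^bsub>?Q\<^esub> (I +> b) = I +> (a \<otimes> b)" if "a \<in> carrier R" "b \<in> carrier R" for a b
    using rcoset_mult_add[OF that] by (simp add: FactRing_def)
  have rep: "\<exists>a\<in>carrier R. a \<notin> I \<and> I +> a \<in> K" if "rng_ideal K ?Q" "K \<noteq> {\<zero>\<^bsub>?Q\<^esub>}" for K
  proof -
    interpret K: rng_ideal K ?Q by (rule that(1))
    have "I \<in> K"
      using additive_subgroup.zero_closed[OF K.additive_subgroup_axioms] by (simp add: zero)
    with that(2) obtain k where "k \<in> K" "k \<noteq> I" by (auto simp: zero)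
    moreover from this obtain a where "a \<in> carrier R" "k = I +> a"
      using K.a_subset carrier by blast
    ultimately show ?thesis using coset by blast
  qed
  have "K = {\<zero>\<^bsub>?Q\<^esub>} \<or> L = {\<zero>\<^bsub>?Q\<^esub>}"
    if KL: "rng_ideal K ?Q" "rng_ideal L ?Q" "ideal_prod ?Q K L = {\<zero>\<^bsub>?Q\<^esub>}" for K L
  proof (rule ccontr)
    assume "\<not> ?thesis"
    then obtain a b where a: "a \<in> carrier R" "a \<notin> I" "I +> a \<in> K"
      and b: "b \<in> carrier R" "b \<notin> I" "I +> b \<in> L"
      using rep KL(1,2) by meson
    obtain c where c: "c \<in> carrier R" "a \<otimes> c \<otimes> b \<notin> I" using prime a b by blast
    have "(I +> a) \<otimes>\<^bsub>?Q\<^esub> (I +> c) \<in> K"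
      using a c carrier by (intro rng_ideal.I_r_closed[OF KL(1)]) auto
    then have "(I +> a) \<otimes>\<^bsub>?Q\<^esub> (I +> c) \<otimes>\<^bsub>?Q\<^esub> (I +> b) \<in> ideal_prod ?Q K L"
      using b by (intro ideal_prod.prod)
    then have "I +> (a \<otimes> c \<otimes> b) = I"
      using a b c KL(3) by (simp add: mult zero)
    then show False using coset a b c by simp
  qed
  moreover have "carrier ?Q \<noteq> {\<zero>\<^bsub>?Q\<^esub>}"
    using assms(1,2) coset unfolding carrier zero by blast
  ultimately show ?thesis
    using quotient_is_rng by (intro prime_rng.intro prime_rng_axioms.intro)
qed

context LV_graph
begin

text \<open>
  The normal form may be chosen after the letter: two arcs of maximal weight leave the tail of
  \<open>\<alpha>\<close>, and one of them is not \<open>\<alpha>\<close>.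
\<close>

lemma ex_special_arcs:
  assumes "\<alpha> \<in> arcs E"
  shows "\<exists>sp. special_arcs E \<omega> sp \<and> sp (tail E \<alpha>) \<noteq> \<alpha>"
proof -
  have "\<exists>\<beta>\<in>out_arcs E v. \<omega> \<beta> = vertex_weight E \<omega> v \<and> \<beta> \<noteq> \<alpha>"
    if "v \<in> verts E" "out_arcs E v \<noteq> {}" for v
  proof (rule ccontr)
    assume "\<not> ?thesis"
    then have "{\<beta> \<in> out_arcs E v. \<omega> \<beta> = vertex_weight E \<omega> v} \<subseteq> {\<alpha>}" by blast
    then have "card {\<beta> \<in> out_arcs E v. \<omega> \<beta> = vertex_weight E \<omega> v} \<le> 1"
      using card_mono[of "{\<alpha>}"] by fastforce
    then show False using two_maximal[OF that] by simp
  qed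
  then have "\<forall>v. \<exists>\<beta>. v \<in> verts E \<and> out_arcs E v \<noteq> {} \<longrightarrow>
      \<beta> \<in> out_arcs E v \<and> \<omega> \<beta> = vertex_weight E \<omega> v \<and> \<beta> \<noteq> \<alpha>"
    by blast
  then obtain sp where sp: "v \<in> verts E \<and> out_arcs E v \<noteq> {} \<longrightarrow>
      sp v \<in> out_arcs E v \<and> \<omega> (sp v) = vertex_weight E \<omega> v \<and> sp v \<noteq> \<alpha>" for v
    by metis
  have "special_arcs E \<omega> sp"
    by unfold_locales (use sp in blast)+
  moreover have "sp (tail E \<alpha>) \<noteq> \<alpha>"
    using sp[of "tail E \<alpha>"] assms by auto
  ultimately show ?thesis by blast
qed

section \<open>Nonzero products along connecting paths\<close>

lemma vertex_not_in_wlpa_ideal: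
  fixes v :: 'v
  assumes "v \<in> verts E"
  shows "letter (Vertex v) \<notin> (wlpa_ideal :: (_ \<Rightarrow>\<^sub>0 'r::ring_1) set)"
proof -
  obtain sp where "special_arcs E \<omega> sp" using ex_special_arcs arcs_nonempty by blast
  then show ?thesis using assms by (rule special_arcs.vertex_not_in_ideal)
qed

text \<open>The special arcs are chosen inside the proof and do not occur in the statement, which
  can therefore be applied repeatedly to letters that require different choices.\<close>

lemma mult_second_letter_not_in_ideal:
  fixes f g :: "('v, 'e) symbol list \<Rightarrow>\<^sub>0 'r::ring_1_no_zero_divisors"
  assumes \<alpha>: "\<alpha> \<in> arcs E" "x = Edge \<alpha> 2 \<or> x = Ghost \<alpha> 2"
    and f: "f \<in> free_carrier" "f * letter (Vertex (source E x)) \<notin> wlpa_ideal"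
    and g: "g \<in> free_carrier" "letter (Vertex (target E x)) * g \<notin> wlpa_ideal"
  shows "f * letter x * g \<notin> wlpa_ideal"
proof -
  obtain sp where "special_arcs E \<omega> sp" and sp: "sp (tail E \<alpha>) \<noteq> \<alpha>"
    using ex_special_arcs[OF \<alpha>(1)] by blast
  then interpret special_arcs E \<omega> sp by simp
  have "x \<in> symbols E \<omega>"
    using \<alpha> weight_ge_2 by (auto simp: symbols_def)
  moreover have "\<not> forb x y" "\<not> forb y x" for y
    using \<alpha>(2) sp by (cases y; auto)+
  ultimately show ?thesis
    using \<alpha>(2) f g by (intro mult_letter_not_in_ideal) auto
qed

text \<open>As all weights are at least \<open>2\<close>, every letter has a parallel letter of
  index \<open>2\<close>, by which it can be replaced in a path.\<close>

lemma ex_second_letter: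
  assumes "x \<in> edges E \<omega> \<union> ghosts E \<omega>"
  obtains \<alpha> y where "\<alpha> \<in> arcs E" "y = Edge \<alpha> 2 \<or> y = Ghost \<alpha> 2"
    "y \<in> symbols E \<omega>" "source E y = source E x" "target E y = target E x"
proof -
  from assms consider \<alpha> i where "\<alpha> \<in> arcs E" "x = Edge \<alpha> i" | \<alpha> i where "\<alpha> \<in> arcs E" "x = Ghost \<alpha> i"
    by (auto simp: edges_def ghosts_def)
  then show thesis
  proof cases
    case (1 \<alpha> i)
    then show ?thesis using weight_ge_2 that[of \<alpha> "Edge \<alpha> 2"] by (simp add: symbols_def edges_def)
  next
    case (2 \<alpha> i)
    then show ?thesis using weight_ge_2 that[of \<alpha> "Ghost \<alpha> 2"] by (simp add: symbols_def ghosts_def)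
  qed
qed

lemma vertex_idem:
  assumes "v \<in> verts E"
  shows "letter (Vertex v) * letter (Vertex v) - letter (Vertex v) \<in> wlpa_ideal"
  using source_mult[of "Vertex v"] assms by simp

lemma vertex_idem_not_in_ideal:
  "v \<in> verts E \<Longrightarrow> letter (Vertex v) * letter (Vertex v) \<notin> (wlpa_ideal :: (_ \<Rightarrow>\<^sub>0 'r::ring_1) set)"
  using wlpa_ideal_cong[OF vertex_idem] vertex_not_in_wlpa_ideal by blast

text \<open>The path is consumed from its beginning while \<open>f\<close> grows to the right by
  letters of index \<open>2\<close>. Each letter is multiplied by its end vertex, so that the
  product again satisfies the hypothesis for the next letter.\<close>

lemma mult_walk_not_in_ideal:
  fixes f :: "('v, 'e) symbol list \<Rightarrow>\<^sub>0 'r::ring_1_no_zero_divisors"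
  assumes "set p \<subseteq> edges E \<omega> \<union> ghosts E \<omega>" "successively (\<lambda>x y. target E x = source E y) p" "p \<noteq> []"
    and "f \<in> free_carrier" "f * letter (Vertex (source E (hd p))) \<notin> wlpa_ideal"
  shows "\<exists>h\<in>free_carrier. f * h * letter (Vertex (target E (last p))) \<notin> wlpa_ideal"
  using assms
proof (induction p arbitrary: f)
  case (Cons x p)
  obtain \<alpha> y where y: "\<alpha> \<in> arcs E" "y = Edge \<alpha> 2 \<or> y = Ghost \<alpha> 2"
      "y \<in> symbols E \<omega>" "source E y = source E x" "target E y = target E x"
    using ex_second_letter[of x] Cons.prems(1) by auto
  \<comment> \<open>Here the right factor is the vertex at the end of \<open>y\<close>; its product
    with itself is congruent to itself and hence outside the ideal.\<close>
  have fy: "f * letter y * letter (Vertex (target E x)) \<notin> wlpa_ideal"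
    using mult_second_letter_not_in_ideal[OF y(1,2) Cons.prems(4), of "letter (Vertex (target E x))"]
      Cons.prems(5) y source_target_verts[OF y(3)]
      vertex_idem_not_in_ideal[of "target E x", where 'r='r] by simp
  show ?case
  proof (cases "p = []")
    case True
    then show ?thesis using fy y(3) by (intro bexI[of _ "letter y"]) simp_all
  next
    case False
    then have "\<exists>h\<in>free_carrier. f * letter y * h * letter (Vertex (target E (last p))) \<notin> wlpa_ideal"
      using Cons.prems y(3) fy by (intro Cons.IH) (auto simp: successively_Cons)
    then obtain h where "h \<in> free_carrier"
        "f * (letter y * h) * letter (Vertex (target E (last p))) \<notin> wlpa_ideal"
      by (auto simp: mult.assoc)
    then show ?thesis using False y(3) by (intro bexI[of _ "letter y * h"]) simp_all
  qed
qed simp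

lemma mult_connected_not_in_ideal:
  fixes f :: "('v, 'e) symbol list \<Rightarrow>\<^sub>0 'r::ring_1_no_zero_divisors"
  assumes "v \<in> verts E" "w \<in> verts E" "f \<in> free_carrier" "f * letter (Vertex v) \<notin> wlpa_ideal"
  shows "\<exists>h\<in>free_carrier. f * h * letter (Vertex w) \<notin> wlpa_ideal"
proof -
  obtain p where p: "generalised_path E \<omega> p" "source E (hd p) = v" "target E (last p) = w"
    using connected[OF assms(1,2)] by blast
  then consider "v = w"
    | "set p \<subseteq> edges E \<omega> \<union> ghosts E \<omega>" "successively (\<lambda>x y. target E x = source E y) p" "p \<noteq> []"
    by (auto simp: generalised_path_def)
  then show ?thesis
  proof cases
    case 1
    have "f * letter (Vertex v) * letter (Vertex v) - f * letter (Vertex v) \<in> wlpa_ideal"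
      using wlpa_ideal_closed(4)[OF vertex_idem[OF assms(1)] assms(3)]
      by (simp add: right_diff_distrib mult.assoc)
    then have "f * letter (Vertex v) * letter (Vertex v) \<notin> wlpa_ideal"
      using assms(4) wlpa_ideal_cong by blast
    with 1 assms(1) show ?thesis by (intro bexI[of _ "letter (Vertex v)"]) simp_all
  next
    case 2
    then show ?thesis using mult_walk_not_in_ideal[OF 2 assms(3)] p assms(4) by simp
  qed
qed

lemma ex_second_letter_into:
  assumes "w \<in> verts E"
  obtains \<alpha> x where "\<alpha> \<in> arcs E" "x = Edge \<alpha> 2 \<or> x = Ghost \<alpha> 2" "x \<in> symbols E \<omega>" "target E x = w"
proof -
  obtain \<beta> where \<beta>: "\<beta> \<in> arcs E" using arcs_nonempty by blast
  then obtain p where p: "generalised_path E \<omega> p" "source E (hd p) = tail E \<beta>" "target E (last p) = w"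
    using connected[of "tail E \<beta>" w] assms by auto
  then consider "w = tail E \<beta>" | "p \<noteq> []" "set p \<subseteq> edges E \<omega> \<union> ghosts E \<omega>"
    by (auto simp: generalised_path_def)
  then show thesis
  proof cases
    \<comment> \<open>If the connecting path has length zero, a ghost of \<open>\<beta>\<close> ends
      in \<open>w\<close>, since ghosts run from the head to the tail.\<close>
    case 1
    then show ?thesis
      using \<beta> weight_ge_2 by (intro that[of \<beta> "Ghost \<beta> 2"]) (simp_all add: symbols_def ghosts_def)
  next
    case 2
    then have "last p \<in> edges E \<omega> \<union> ghosts E \<omega>" using last_in_set by blast
    then show ?thesis by (rule ex_second_letter) (use that p(3) in auto)
  qed
qed

text \<open>The connecting path is directed to the source of a letter \<open>x\<close> of index
  \<open>2\<close> that ends in \<open>w\<close>, and not to \<open>w\<close> itself. Thus the last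
  multiplication, by \<open>x\<close> and \<open>g\<close>, is again one across a separating
  letter.\<close>

lemma ex_mult_not_in_ideal:
  fixes f g :: "('v, 'e) symbol list \<Rightarrow>\<^sub>0 'r::ring_1_no_zero_divisors"
  assumes "f \<in> free_carrier" "g \<in> free_carrier" "f \<notin> wlpa_ideal" "g \<notin> wlpa_ideal"
  shows "\<exists>h\<in>free_carrier. f * h * g \<notin> wlpa_ideal"
proof -
  obtain v where v: "v \<in> verts E" "f * letter (Vertex v) \<notin> wlpa_ideal"
    using ex_vertex_mult(2)[OF assms(1,3)] by blast
  obtain w where w: "w \<in> verts E" "letter (Vertex w) * g \<notin> wlpa_ideal"
    using ex_vertex_mult(1)[OF assms(2,4)] by blast
  obtain \<alpha> x where x: "\<alpha> \<in> arcs E" "x = Edge \<alpha> 2 \<or> x = Ghost \<alpha> 2" "x \<in> symbols E \<omega>" "target E x = w"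
    using ex_second_letter_into[OF w(1)] .
  obtain h where h: "h \<in> free_carrier" "f * h * letter (Vertex (source E x)) \<notin> wlpa_ideal"
    using mult_connected_not_in_ideal[OF v(1) _ assms(1) v(2)] source_target_verts[OF x(3)] by blast
  have "f * h * letter x * g \<notin> wlpa_ideal"
    using x h assms(1,2) w(2) by (intro mult_second_letter_not_in_ideal[OF x(1,2)]) simp_all
  then show ?thesis
    using h(1) x(3) by (intro bexI[of _ "h * letter x"]) (simp_all add: mult.assoc)
qed

end

theorem theorem46:
  fixes E :: "('v, 'e) pre_digraph" and \<omega> :: "'e \<Rightarrow> nat"
  assumes "LV_graph E \<omega>"
  shows "prime_rng
    (wlpa E \<omega> :: (('v, 'e) symbol list \<Rightarrow>\<^sub>0 'r::ring_1_no_zero_divisors) set ring)"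
proof -
  interpret LV_graph E \<omega> by (rule assms)
  let ?F = "free_rng (symbols E \<omega>) :: (('v, 'e) symbol list \<Rightarrow>\<^sub>0 'r) ring"
  interpret rng_ideal wlpa_ideal ?F
    using wlpa_ideal_coeff_ideal[where 'r='r] by (simp add: coeff_ideal_def)
  obtain v where v: "v \<in> verts E" using arcs_nonempty by (meson all_not_in_conv tail_in_verts)
  have mult: "f \<otimes>\<^bsub>?F\<^esub> g = f * g" for f g by (simp add: free_rng_def)
  show ?thesis
    unfolding wlpa_def
  proof (rule prime_rng_quotientI)
    show "letter (Vertex v) \<in> carrier ?F" using v by simp
    show "letter (Vertex v) \<notin> (wlpa_ideal :: (('v, 'e) symbol list \<Rightarrow>\<^sub>0 'r) set)"
      using v by (rule vertex_not_in_wlpa_ideal)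
  next
    fix f g :: "('v, 'e) symbol list \<Rightarrow>\<^sub>0 'r"
    assume "f \<in> carrier ?F" "g \<in> carrier ?F" "f \<notin> wlpa_ideal" "g \<notin> wlpa_ideal"
    then show "\<exists>h\<in>carrier ?F. f \<otimes>\<^bsub>?F\<^esub> h \<otimes>\<^bsub>?F\<^esub> g \<notin> wlpa_ideal"
      unfolding mult by (rule ex_mult_not_in_ideal)
  qed
qed

end
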